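(* Let $b$ be a real number. The following implications hold: 1. if $b> \sqrt{2-2 \sin(\frac{18 \pi}{325})}$ $(\approx 1.28599)$, then $\chi(G_{[1,b]})\ge 7$; 2. if $b> \sqrt{2+2\sin(\frac{\pi}{38})}$ $(\approx 1.47145)$, then $\chi(G_{[1,b]})\ge 8$; 3. if $b> \sqrt{2+2\sin(\frac{7\pi}{45})}$ $(\approx 1.71433)$, then $\chi(G_{[1,b]})\ge 9$; 4. if $b> 2\sqrt{2}-1$ $(\approx 1.82843)$, then $\chi(G_{[1,b]})\ge 10$; 5. if $b> \frac{1}{3}(5 - \sqrt{2} + \sqrt{6})$ $(\approx 2.01176)$, then $\chi(G_{[1,b]})\ge 11$.
   Context: For real $b>1$, $G_{[1,b]}$ is the graph with vertex set $\mathbb{R}^2$ in which two points $x,y$ are adjacent if and only if their Euclidean distance satisfies $1\le \mathrm{dist}(x,y)\le b$. A proper coloring of a graph is an arbitrary function from its vertex set to a set of colors (no measurability or regularity is required) giving different colors to adjacent vertices; $\chi(G)$ denotes the chromatic number, i.e. the minimal cardinality of a set of colors for which a proper coloring of $G$ exists. *)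

theory Defs
  imports "HOL-Analysis.Analysis" "HOL-Library.Extended_Nat"
begin

text \<open>A graph is a vertex set together with an adjacency relation.\<close>

type_synonym 'v graph = "'v set \<times> 'v rel"

definition proper_coloring :: "'v graph \<Rightarrow> ('v \<Rightarrow> 'c) \<Rightarrow> bool" where
  "proper_coloring G f \<longleftrightarrow>
     (\<forall>x\<in>fst G. \<forall>y\<in>fst G. (x, y) \<in> snd G \<longrightarrow> f x \<noteq> f y)"

text \<open>
  All infinite chromatic numbers are identified with \<open>\<infinity>\<close>, the infimum of the empty set.
  Since every finite set of colors is equinumerous to a finite set of natural numbers,
  it is enough to consider color sets of type \<^typ>\<open>nat set\<close>; see
  \<open>chromatic_number_le\<close>.
\<close>

definition chromatic_number :: "'v graph \<Rightarrow> enat" where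
  "chromatic_number G =
     Inf {enat (card C) | C :: nat set.
            finite C \<and> (\<exists>f. f ` fst G \<subseteq> C \<and> proper_coloring G f)}"

lemma chromatic_number_le:
  fixes f :: "'v \<Rightarrow> 'c"
  assumes "proper_coloring G f" and "f ` fst G \<subseteq> C" and "finite C"
  shows "chromatic_number G \<le> enat (card C)"
proof -
  obtain h :: "'c \<Rightarrow> nat" where h: "inj_on h C"
    using finite_imp_inj_to_nat_seg[OF assms(3)] by blast
  have "proper_coloring G (h \<circ> f)"
    using assms(1,2) h unfolding proper_coloring_def
    by (metis comp_apply image_subset_iff inj_on_eq_iff)
  moreover have "(h \<circ> f) ` fst G \<subseteq> h ` C" "finite (h ` C)"
    using assms(2,3) by auto
  ultimately have "enat (card (h ` C)) \<in> {enat (card C) | C :: nat set.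
      finite C \<and> (\<exists>f. f ` fst G \<subseteq> C \<and> proper_coloring G f)}"
    by blast
  then have "chromatic_number G \<le> enat (card (h ` C))"
    unfolding chromatic_number_def by (rule Inf_lower)
  then show ?thesis
    using card_image[OF h] by simp
qed

text \<open>The graph $G_{[1,b]}$ on the Euclidean plane.\<close>

definition annulus_graph :: "real \<Rightarrow> (real ^ 2) graph" where
  "annulus_graph b = (UNIV, {(x, y). 1 \<le> dist x y \<and> dist x y \<le> b})"

end

theory Submission
  imports Defs
begin

text \<open>
  Suppose that $G_{[1,b]}$ is coloured with $k$ colours. Points that are joined by a chain of
  very short steps inside one colour class are at distance less than $1$, because the distance
  from the starting point can never jump over $[1,b]$. So the monochromatic pieces are small, and
  Sperner's lemma yields three points of pairwise different colours, arbitrarily close to each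
  other; let $p$ be their location. On a circle around $p$ with radius slightly larger than $1$,
  the colouring cannot be locally constant, so there are two differently coloured points
  arbitrarily close to some $q$ on that circle. Hence $p$ blocks three colours and $q$ blocks two
  colours for their respective neighbours. After a rotation, $p$ is the origin and $q$ lies on
  the positive real axis, and a search over finitely many points of the annulus around $p$ shows
  that the remaining colours do not suffice. The points have integer coordinates after scaling
  and all inequalities between distances are strict, which leaves room for the approximations.
\<close>

subsection \<open>Certificates for non-colourability\<close>

text \<open>
  The state of the search is a list of sets of vertices that already received pairwise different
  colours. A vertex \<open>v\<close> is put into each of these sets in turn, unless the set contains a
  neighbour of \<open>v\<close>, and finally into a new one if fewer than \<open>k\<close> colours are in use; the list in
  \<open>Branch v ts\<close> contains one certificate for each of these possibilities, in this order. Working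
  with sets instead of colours avoids the treatment of equivalent colourings.
\<close>

datatype 'v cert = Branch 'v "'v cert list"

text \<open>In \<open>refutes_vertex\<close>, \<open>pre\<close> holds the classes that have been
  dealt with for the current vertex, so that the whole list can be rebuilt in its original order
  when the vertex joins a later class. A class with a neighbour of the vertex consumes no
  certificate, and the certificates have to be used up exactly at the end of the list.\<close>

fun refutes :: "nat \<Rightarrow> ('v \<Rightarrow> 'v \<Rightarrow> bool) \<Rightarrow> 'v cert \<Rightarrow> 'v list list \<Rightarrow> bool"
  and refutes_vertex :: "nat \<Rightarrow> ('v \<Rightarrow> 'v \<Rightarrow> bool) \<Rightarrow> 'v \<Rightarrow> 'v cert list \<Rightarrow> 'v list list \<Rightarrow> 'v list list \<Rightarrow> bool"
where
  "refutes k E (Branch v ts) cls = refutes_vertex k E v ts [] cls"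
| "refutes_vertex k E v ts pre [] =
     (if length pre < k then (case ts of [t] \<Rightarrow> refutes k E t (pre @ [[v]]) | _ \<Rightarrow> False)
      else ts = [])"
| "refutes_vertex k E v ts pre (c # post) =
     (if list_ex (E v) c then refutes_vertex k E v ts (pre @ [c]) post
      else (case ts of [] \<Rightarrow> False
            | t # ts' \<Rightarrow> refutes k E t (pre @ (v # c) # post) \<and>
                refutes_vertex k E v ts' (pre @ [c]) post))"

text \<open>
  \<open>R v c\<close> is a relation because a vertex stands for a small neighbourhood, which may contain points
  of several colours.
\<close>

definition realizes :: "'c set \<Rightarrow> ('v \<Rightarrow> 'c \<Rightarrow> bool) \<Rightarrow> 'v list list \<Rightarrow> 'c list \<Rightarrow> bool" where
  "realizes C R cls cs \<longleftrightarrow>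
     distinct cs \<and> set cs \<subseteq> C \<and> list_all2 (\<lambda>vs c. \<forall>v\<in>set vs. R v c) cls cs"

text \<open>The search is followed along an actual colouring. Some colour \<open>c\<close> is
  related to the vertex; it is the colour of the current class, and then the vertex joins that
  class, or the class is passed over. The second statement describes the walk along the list: the
  colours of the classes passed so far differ from \<open>c\<close>. If all classes are passed, then
  \<open>c\<close> is new, and a new class must be permitted because \<open>C\<close> has at most
  \<open>k\<close> elements.\<close>

lemma refutes_sound:
  fixes R :: "'v \<Rightarrow> 'c \<Rightarrow> bool"
  assumes C: "finite C" "card C \<le> k"
    and total: "\<And>v. \<exists>c\<in>C. R v c"
    and edge: "\<forall>v w c. E v w \<longrightarrow> R v c \<longrightarrow> \<not> R w c"
  shows "refutes k E t cls \<Longrightarrow> realizes C R cls cs \<Longrightarrow> False"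
    and "refutes_vertex k E v ts pre post \<Longrightarrow> realizes C R (pre @ post) cs \<Longrightarrow> c \<in> C \<Longrightarrow> R v c
           \<Longrightarrow> c \<notin> set (take (length pre) cs) \<Longrightarrow> False"
  \<comment> \<open>The induction rule varies \<open>k\<close> and \<open>E\<close>, so the facts
    that mention them enter the induction as premises.\<close>
  using C(2) edge
proof (induction k E t cls and k E v ts pre post arbitrary: cs and cs c
    rule: refutes_refutes_vertex.induct)
  case (1 k E v ts cls)
  obtain c where "c \<in> C" "R v c" using total by blast
  then show ?case using "1.IH"[of cs c] "1.prems" by simp
next
  case (2 k E v ts pre)
  have len: "length cs = length pre"
    using "2.prems" by (auto simp: realizes_def dest: list_all2_lengthD)
  have new: "c \<notin> set cs" using "2.prems" len by simp
  have "distinct (c # cs)" "set (c # cs) \<subseteq> C"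
    using "2.prems" new by (auto simp: realizes_def)
  then have "length (c # cs) \<le> card C"
    using distinct_card[of "c # cs"] card_mono[OF C(1)] by metis
  \<comment> \<open>With \<open>c\<close> there is one more colour than there are classes, which
    excludes the case in which all \<open>k\<close> colours are in use.\<close>
  then have lt: "length pre < k" using len "2.prems" by simp
  then obtain t where ts: "ts = [t]" and t: "refutes k E t (pre @ [[v]])"
    using "2.prems"(1) by (auto split: list.splits)
  have "realizes C R (pre @ [[v]]) (cs @ [c])"
    using "2.prems" new by (auto simp: realizes_def intro!: list_all2_appendI)
  then show ?case using "2.IH" lt ts t "2.prems" by blast
next
  case (3 k E v ts pre vs post)
  define n where "n = length pre"
  have len: "length cs = n + Suc (length post)"
    using "3.prems" by (auto simp: realizes_def n_def dest: list_all2_lengthD)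
  define d where "d = cs ! n"
  have cs: "cs = take n cs @ d # drop (Suc n) cs"
    using len by (simp add: d_def id_take_nth_drop)
  have all: "list_all2 (\<lambda>vs c. \<forall>v\<in>set vs. R v c) (pre @ vs # post) (take n cs @ d # drop (Suc n) cs)"
    using "3.prems" cs by (simp add: realizes_def)
  have parts: "list_all2 (\<lambda>vs c. \<forall>v\<in>set vs. R v c) pre (take n cs)"
     "\<forall>v\<in>set vs. R v d" "list_all2 (\<lambda>vs c. \<forall>v\<in>set vs. R v c) post (drop (Suc n) cs)"
    using all len by (auto simp: list_all2_append n_def)
  have re: "realizes C R ((pre @ [vs]) @ post) cs" using "3.prems" by simp
  \<comment> \<open>The class \<open>vs\<close> is passed over in two situations: it contains a
    neighbour of \<open>v\<close>, or its colour \<open>d\<close> merely differs from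
    \<open>c\<close>. The induction hypothesis of either situation is supplied as the third
    assumption.\<close>
  have skip: False if "c \<noteq> d" "refutes_vertex k E v ts' (pre @ [vs]) post"
    "\<And>cs c. refutes_vertex k E v ts' (pre @ [vs]) post \<Longrightarrow> realizes C R ((pre @ [vs]) @ post) cs \<Longrightarrow>
       c \<in> C \<Longrightarrow> R v c \<Longrightarrow> c \<notin> set (take (length (pre @ [vs])) cs) \<Longrightarrow> card C \<le> k \<Longrightarrow>
       \<forall>v w c. E v w \<longrightarrow> R v c \<longrightarrow> \<not> R w c \<Longrightarrow> False" for ts'
  proof -
    have "take (length (pre @ [vs])) cs = take n cs @ [d]"
      using len by (simp add: n_def d_def take_Suc_conv_app_nth)
    then show False using that(3)[OF that(2) re] that(1) "3.prems" by (auto simp: n_def)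
  qed
  show ?case
  proof (cases "list_ex (E v) vs")
    case True
    then obtain w where "w \<in> set vs" "E v w" by (auto simp: list_ex_iff)
    then have "c \<noteq> d" using parts(2) "3.prems" by blast
    moreover have "refutes_vertex k E v ts (pre @ [vs]) post" using "3.prems"(1) True by simp
    ultimately show ?thesis using skip "3.IH"(1)[OF True] by blast
  next
    case False
    then obtain t ts' where ts: "ts = t # ts'" and t: "refutes k E t (pre @ (v # vs) # post)"
      and ts': "refutes_vertex k E v ts' (pre @ [vs]) post"
      using "3.prems"(1) by (auto split: list.splits)
    show ?thesis
    proof (cases "c = d")
      case True
      have "list_all2 (\<lambda>vs c. \<forall>v\<in>set vs. R v c) (pre @ (v # vs) # post) (take n cs @ d # drop (Suc n) cs)"
        using parts True "3.prems" by (auto intro!: list_all2_appendI)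
      then have "realizes C R (pre @ (v # vs) # post) cs"
        using "3.prems" cs by (simp add: realizes_def)
      then show ?thesis using "3.IH"(2)[OF False ts t] "3.prems" by blast
    next
      case c: False
      show ?thesis using skip[OF c ts'] "3.IH"(3)[OF False ts] by blast
    qed
  qed
qed

subsection \<open>Points where several colours meet\<close>

text \<open>A monochromatic piece is a class of the relation generated by steps shorter than
  \<open>\<delta>\<close> inside one colour. Each piece stays within distance 1 of any of its
  points, so it cannot join opposite sides of a square of side larger than 1. Labels that are
  constant on pieces can therefore satisfy the boundary conditions of Sperner's lemma on a fine
  grid. Vertices of one simplex with different labels lie in different pieces and, being close, must
  differ in colour.\<close>

lemma exists_trichromatic:
  fixes g :: "complex \<Rightarrow> 'c" and b e :: real
  assumes b: "b > 1" and e: "e > 0"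
    and g: "\<And>x y. 1 \<le> dist x y \<Longrightarrow> dist x y \<le> b \<Longrightarrow> g x \<noteq> g y"
  obtains x y z where "dist x y < e" "dist x z < e" "g x \<noteq> g y" "g x \<noteq> g z" "g y \<noteq> g z"
proof -
  \<comment> \<open>The bound \<open>b - 1\<close> prevents a step that starts at distance below 1
    from jumping beyond \<open>b\<close>; the bound \<open>e\<close> makes the three points
    close.\<close>
  define \<delta> where "\<delta> = min e (b - 1)"
  have \<delta>: "\<delta> > 0" "\<delta> \<le> e" "\<delta> \<le> b - 1" using b e by (auto simp: \<delta>_def)
  define r where "r = {(x, y). dist x y < \<delta> \<and> g x = g y}"
  have "sym r" by (auto simp: r_def sym_def dist_commute)
  then have sym: "(y, x) \<in> r\<^sup>*" if "(x, y) \<in> r\<^sup>*" for x y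
    using that sym_rtrancl by (auto dest: symD)
  \<comment> \<open>After one more step the distance from \<open>x\<close> is below
    \<open>b\<close>. As the colour is that of \<open>x\<close>, it is not in [1,b], so it is again
    below 1.\<close>
  have small: "dist x y < 1 \<and> g x = g y" if "(x, y) \<in> r\<^sup>*" for x y
    using that
  proof (induction rule: rtrancl_induct)
    case (step y z)
    have "dist y z < \<delta>" "g y = g z" using step by (auto simp: r_def)
    moreover from this have "dist x z < b"
      using step dist_triangle[of x z y] \<delta> by linarith
    ultimately show ?case using g[of x z] step by force
  qed simp
  \<comment> \<open>The diagonal of a grid cell of width \<open>h\<close> is shorter than
    \<open>\<delta>\<close>. The number \<open>p\<close> of cells per side is chosen below such that
    the side length \<open>h * real p\<close> exceeds 1.\<close>
  define h where "h = \<delta> / 2"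
  define pt :: "(nat \<Rightarrow> nat) \<Rightarrow> complex" where "pt = (\<lambda>x. Complex (h * real (x 0)) (h * real (x 1)))"
  obtain p :: nat where p: "1 / h < real p" using reals_Archimedean2 by blast
  have h: "h > 0" using \<delta> by (simp add: h_def)
  have p1: "h * real p > 1" "p > 0" using p h by (auto simp: field_simps intro: gr0I)
  \<comment> \<open>The labels depend only on the monochromatic piece, so a simplex that carries all labels meets
    three pieces.\<close>
  define low :: "(complex \<Rightarrow> real) \<Rightarrow> complex \<Rightarrow> nat" where
    "low = (\<lambda>f x. if \<exists>w. (x, w) \<in> r\<^sup>* \<and> f w \<le> 0 then 0 else 1)"
  define lab :: "(nat \<Rightarrow> nat) \<Rightarrow> nat \<Rightarrow> nat" where
    "lab = (\<lambda>x j. if j = 0 then low Re (pt x) else low Im (pt x))"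
  have low_cong: "low f x = low f y" if "(x, y) \<in> r\<^sup>*" for f x y
    unfolding low_def using that sym rtrancl_trans by metis
  have lo: "low f x = 0" if "f x \<le> 0" for f x using that by (auto simp: low_def)
  \<comment> \<open>Points of the piece of \<open>x\<close> are at distance less than 1 from
    \<open>x\<close>, so a coordinate above 1 cannot drop to 0 within the piece.\<close>
  have hi: "low f x = 1" if "f x > 1" "\<And>w. f x - f w \<le> dist x w" for f x
  proof -
    have "\<not> f w \<le> 0" if "(x, w) \<in> r\<^sup>*" for w
      using small[OF that] \<open>f x > 1\<close> \<open>f x - f w \<le> dist x w\<close> by linarith
    then show ?thesis by (auto simp: low_def)
  qed
  have re: "Re x - Re w \<le> dist x w" and im: "Im x - Im w \<le> dist x w" for x w
    using abs_Re_le_cmod[of "x - w"] abs_Im_le_cmod[of "x - w"] by (auto simp: dist_norm)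
  \<comment> \<open>This is Kuhn's form of Sperner's lemma. \<open>reduced 2\<close> turns the two
    binary labels into one of 0, 1, 2, namely the index of the first nonzero label, or 2 if there is
    none.\<close>
  have "odd (card {s. ksimplex p 2 s \<and> (reduced 2 \<circ> lab) ` s = {..2}})"
  proof (rule kuhn_combinatorial[OF p1(2)]; intro allI impI)
    fix x :: "nat \<Rightarrow> nat" and j
    assume *: "(\<forall>j. x j \<le> p) \<and> j < 2 \<and> x j = 0"
    then have "j = 0 \<or> j = 1" by auto
    then show "lab x j = 0" using * lo[of Re "pt x"] lo[of Im "pt x"] by (auto simp: lab_def pt_def)
  next
    fix x :: "nat \<Rightarrow> nat" and j
    assume *: "(\<forall>j. x j \<le> p) \<and> j < 2 \<and> x j = p"
    then have "j = 0 \<or> j = 1" by auto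
    then show "lab x j = 1" using * p1 hi[of Re "pt x", OF _ re] hi[of Im "pt x", OF _ im]
      by (auto simp: lab_def pt_def)
  qed
  then have "{s. ksimplex p 2 s \<and> (reduced 2 \<circ> lab) ` s = {..2}} \<noteq> {}"
    by (rule odd_card_imp_not_empty)
  then obtain s c u where "kuhn_simplex p 2 c u s" and rl: "(reduced 2 \<circ> lab) ` s = {..2}"
    by (auto elim: ksimplex.cases)
  then interpret kuhn_simplex p 2 c u s by simp
  have close: "dist (pt x) (pt y) < \<delta>" if "x \<in> s" "y \<in> s" for x y
  proof -
    have *: "\<bar>h * real (x j) - h * real (y j)\<bar> \<le> h" for j
    proof -
      \<comment> \<open>All vertices of the simplex lie in the unit cube whose lowest corner is
        \<open>base\<close>.\<close>
      have "\<bar>real (x j) - real (y j)\<bar> \<le> 1"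
        using le_Suc_base[OF that(1), of j] base_le[OF that(1), of j]
          le_Suc_base[OF that(2), of j] base_le[OF that(2), of j] by linarith
      then have "h * \<bar>real (x j) - real (y j)\<bar> \<le> h * 1" using h by (intro mult_left_mono) auto
      then show ?thesis using h by (simp add: abs_mult flip: right_diff_distrib)
    qed
    have "(dist (pt x) (pt y))\<^sup>2 \<le> h\<^sup>2 + h\<^sup>2"
      unfolding pt_def dist_norm cmod_power2 using *[of 0] *[of 1] h
      by (intro add_mono) (simp_all add: abs_le_square_iff[symmetric])
    also have "\<dots> < \<delta>\<^sup>2" using \<delta> by (simp add: h_def field_simps power2_eq_square)
    finally show ?thesis using \<delta> by (simp add: power2_less_imp_less)
  qed
  have diff: "g (pt x) \<noteq> g (pt y)" if "x \<in> s" "y \<in> s" "reduced 2 (lab x) \<noteq> reduced 2 (lab y)" for x y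
  proof
    assume "g (pt x) = g (pt y)"
    then have "(pt x, pt y) \<in> r\<^sup>*" using close[OF that(1,2)] by (auto simp: r_def)
    then have "lab x = lab y" using low_cong by (auto simp: lab_def)
    then show False using that(3) by simp
  qed
  have "0 \<in> (reduced 2 \<circ> lab) ` s" "1 \<in> (reduced 2 \<circ> lab) ` s" "2 \<in> (reduced 2 \<circ> lab) ` s"
    unfolding rl by auto
  then obtain x y z where "x \<in> s" "y \<in> s" "z \<in> s" "reduced 2 (lab x) = 0" "reduced 2 (lab y) = 1"
    "reduced 2 (lab z) = 2" by auto
  then show thesis
    using that[of "pt x" "pt y" "pt z"] close[of x y] close[of x z] diff[of x y] diff[of x z] diff[of y z] \<delta>
    by auto
qed

text \<open>If every point of the circle had a neighbourhood of one colour, the colouring would be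
  locally constant along the circle and hence constant by connectedness. But a circle of radius
  \<open>\<rho>\<close> has a chord of length 1, whose endpoints need different colours.\<close>

lemma exists_bichromatic_on_circle:
  fixes g :: "complex \<Rightarrow> 'c" and b e \<rho> :: real
  assumes b: "b > 1" and e: "e > 0" and \<rho>: "\<rho> \<ge> 1"
    and g: "\<And>x y. 1 \<le> dist x y \<Longrightarrow> dist x y \<le> b \<Longrightarrow> g x \<noteq> g y"
  obtains u x y where "norm u = 1" "dist x (p + u * of_real \<rho>) < e" "dist y (p + u * of_real \<rho>) < e" "g x \<noteq> g y"
proof (rule ccontr)
  assume no: "\<not> thesis"
  define w where "w = (\<lambda>t::real. p + cis t * of_real \<rho>)"
  have const: "g (w s) = g (w t)" for s t
  proof (rule connected_local_const[of UNIV s t "\<lambda>t. g (w t)"])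
    show "\<forall>a\<in>UNIV. \<forall>\<^sub>F t in at a. g (w a) = g (w t)"
    proof
      fix a
      have "isCont w a" unfolding w_def cis_conv_exp by (intro continuous_intros)
      then have "\<forall>\<^sub>F t in at a. dist (w t) (w a) < e" using e by (auto simp: isCont_def tendsto_iff)
      then show "\<forall>\<^sub>F t in at a. g (w a) = g (w t)"
      proof eventually_elim
        case (elim t)
        \<comment> \<open>Different colours at \<open>w a\<close> and \<open>w t\<close> would give
          the desired pair, with \<open>cis a\<close> as the direction.\<close>
        then show ?case using that[of "cis a" "w a" "w t"] no e by (auto simp: w_def)
      qed
    qed
  qed auto
  \<comment> \<open>This is half the angle at the centre that spans a chord of length 1.\<close>
  define t where "t = arcsin (1 / (2 * \<rho>))"
  have t: "sin t = 1 / (2 * \<rho>)" using \<rho> unfolding t_def by (intro sin_arcsin) (auto simp: field_simps)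
  have "w t - w (- t) = of_real (2 * \<rho> * sin t) * \<i>"
    by (simp add: w_def complex_eq_iff)
  also have "\<dots> = \<i>" using \<rho> by (simp add: t)
  finally have "dist (w t) (w (- t)) = 1" by (simp add: dist_norm)
  then show False using g[of "w t" "w (- t)"] const[of t "- t"] b by simp
qed

section \<open>Reduction from the plane to a finite graph of integer points\<close>

definition annulus_adj :: "int \<Rightarrow> int \<Rightarrow> int \<times> int \<Rightarrow> int \<times> int \<Rightarrow> bool" where
  "annulus_adj l m v w = (let d = (fst v - fst w)\<^sup>2 + (snd v - snd w)\<^sup>2 in l < d \<and> d < m)"

text \<open>The graph lives on \<open>real ^ 2\<close>, whereas the argument uses complex numbers,
  where a rotation is multiplication by a number of norm 1.\<close>

lemma dist_vector_2:
  "dist (vector [x, y] :: real ^ 2) (vector [x', y']) = dist (Complex x y) (Complex x' y')"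
  by (simp add: dist_vec_def L2_set_def sum_2 dist_real_def dist_norm cmod_def)

text \<open>Integer points, divided by the scale \<open>s\<close>, are rotated and shifted such that
  \<open>(0, 0)\<close> falls on a place where three colours meet and \<open>(q, 0)\<close> on a
  place where two colours meet. A vertex is related to every colour that occurs within
  \<open>e\<close> of its place. Squared distances of integer points are integers, so the strict
  inequalities in \<open>annulus_adj\<close> leave a fixed margin, and adjacent vertices share no
  colour. A certificate that starts from these five colours then rules out \<open>k\<close>
  colours.\<close>

lemma chromatic_number_annulus_ge:
  fixes b b' :: real and s l m q :: int
  assumes b: "b > b'" "b' > 1" and s: "s > 0" and l: "l = s\<^sup>2" and m: "of_int m \<le> (b' * of_int s)\<^sup>2"
    and q: "s < q" "q\<^sup>2 < m"
    and cert: "refutes k (annulus_adj l m) t [[(0, 0)], [(0, 0)], [(0, 0)], [(q, 0)], [(q, 0)]]"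
  shows "chromatic_number (annulus_graph b) \<ge> enat (Suc k)"
  unfolding chromatic_number_def
\<comment> \<open>If no finite set of colours suffices, the infimum is \<infinity> and the bound is
  immediate; otherwise it is checked for each such set.\<close>
proof (rule Inf_greatest, clarify)
  fix C :: "nat set" and f
  assume C: "finite C" and f: "f ` fst (annulus_graph b) \<subseteq> C" "proper_coloring (annulus_graph b) f"
  define g :: "complex \<Rightarrow> nat" where "g = (\<lambda>z. f (vector [Re z, Im z]))"
  have gC: "g z \<in> C" for z using f(1) by (auto simp: g_def annulus_graph_def)
  have g: "g x \<noteq> g y" if "1 \<le> dist x y" "dist x y \<le> b" for x y
    using f(2) that dist_vector_2[of "Re x" "Im x" "Re y" "Im y"]
    by (auto simp: g_def annulus_graph_def proper_coloring_def)
  define S :: real where "S = of_int s"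
  have S: "S > 0" using s by (simp add: S_def)
  \<comment> \<open>The squared integer distance of adjacent vertices is between
    \<open>s\<^sup>2 + 1\<close> and \<open>m - 1\<close>. Hence the two numbers are half the
    distances from 1 and from \<open>b\<close> to the range of actual distances; the halves account
    for both endpoints being moved by up to \<open>e\<close>.\<close>
  define e where "e = min ((sqrt (S\<^sup>2 + 1) / S - 1) / 2) ((b - sqrt (of_int (m - 1)) / S) / 2)"
  have b1: "b > 1" using b by simp
  have "sqrt (S\<^sup>2 + 1) > S" using S by (intro real_less_rsqrt) simp
  moreover have "sqrt (of_int (m - 1)) < b * S"
  proof (rule real_less_lsqrt)
    have "real_of_int (m - 1) < of_int m" by simp
    also have "\<dots> \<le> (b' * S)\<^sup>2" using m by (simp only: S_def)
    also have "\<dots> \<le> (b * S)\<^sup>2" using b S by (intro power_mono mult_right_mono) auto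
    finally show "of_int (m - 1) < (b * S)\<^sup>2" .
  qed (use b1 S in simp)
  ultimately have e: "e > 0" using S by (simp add: e_def field_simps)
  obtain p p2 p3 where p: "dist p p2 < e" "dist p p3 < e" "g p \<noteq> g p2" "g p \<noteq> g p3" "g p2 \<noteq> g p3"
    using exists_trichromatic[OF b1 e, of g] g by metis
  obtain u x y where u: "norm u = 1" and xy: "dist x (p + u * of_real (of_int q / S)) < e"
      "dist y (p + u * of_real (of_int q / S)) < e" "g x \<noteq> g y"
    using exists_bichromatic_on_circle[OF b1 e, of "of_int q / S" g p] g q S
    by (metis S_def le_divide_eq_1_pos less_imp_le of_int_le_iff)
  \<comment> \<open>The origin goes to \<open>p\<close> and \<open>(q, 0)\<close> goes to the chosen
    point on the circle of radius \<open>of_int q / S\<close> around \<open>p\<close>.\<close>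
  define pos where "pos = (\<lambda>v. p + u * Complex (of_int (fst v) / S) (of_int (snd v) / S))"
  define R where "R = (\<lambda>v c. \<exists>z. dist z (pos v) < e \<and> g z = c)"
  have dpos: "dist (pos v) (pos w) =
      sqrt (of_int ((fst v - fst w)\<^sup>2 + (snd v - snd w)\<^sup>2)) / S" for v w
  proof -
    have "pos v - pos w = u * Complex (of_int (fst v - fst w) / S) (of_int (snd v - snd w) / S)"
      by (simp add: pos_def complex_eq_iff algebra_simps diff_divide_distrib)
    then have "dist (pos v) (pos w) = sqrt ((of_int (fst v - fst w) / S)\<^sup>2 + (of_int (snd v - snd w) / S)\<^sup>2)"
      by (simp only: dist_norm norm_mult u mult_1 complex_norm)
    also have "(of_int (fst v - fst w) / S)\<^sup>2 + (of_int (snd v - snd w) / S)\<^sup>2 =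
        of_int ((fst v - fst w)\<^sup>2 + (snd v - snd w)\<^sup>2) / S\<^sup>2"
      by (simp add: power_divide add_divide_distrib)
    finally show ?thesis using S by (simp add: real_sqrt_divide)
  qed
  have edge: "\<not> R w c" if adj: "annulus_adj l m v w" and R: "R v c" for v w c
  proof
    assume "R w c"
    then obtain z z' where z: "dist z (pos v) < e" "dist z' (pos w) < e" "g z = g z'"
      using R unfolding R_def by metis
    define d where "d = (fst v - fst w)\<^sup>2 + (snd v - snd w)\<^sup>2"
    have d: "s\<^sup>2 + 1 \<le> d" "d \<le> m - 1" using adj by (auto simp: annulus_adj_def d_def l Let_def)
    have dvw: "dist (pos v) (pos w) = sqrt (of_int d) / S" unfolding dpos d_def ..
    have "S\<^sup>2 + 1 \<le> of_int d" using d(1) unfolding S_def by (metis of_int_1 of_int_add of_int_le_iff of_int_power)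
    then have "sqrt (S\<^sup>2 + 1) / S \<le> dist (pos v) (pos w)"
      using S unfolding dvw by (intro divide_right_mono real_sqrt_le_mono) auto
    moreover have "dist (pos v) (pos w) \<le> sqrt (of_int (m - 1)) / S"
      using S d(2) unfolding dvw by (intro divide_right_mono real_sqrt_le_mono) auto
    ultimately have "1 + 2 * e \<le> dist (pos v) (pos w)" "dist (pos v) (pos w) \<le> b - 2 * e"
      by (auto simp: e_def min_def field_simps)
    moreover have "dist (pos v) (pos w) \<le> dist z (pos v) + dist z z' + dist z' (pos w)"
      using dist_triangle[of "pos v" "pos w" z] dist_triangle[of z "pos w" z'] by (simp add: dist_commute)
    moreover have "dist z z' \<le> dist z (pos v) + dist (pos v) (pos w) + dist z' (pos w)"
      using dist_triangle[of z z' "pos v"] dist_triangle[of "pos v" z' "pos w"] by (simp add: dist_commute)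
    ultimately show False using g[of z z'] z by linarith
  qed
  have total: "\<exists>c\<in>C. R v c" for v
    using gC e unfolding R_def by (metis dist_self)
  have O: "R (0, 0) (g p)" "R (0, 0) (g p2)" "R (0, 0) (g p3)"
    using p e by (auto simp: R_def pos_def dist_commute Complex_eq intro: exI[of _ p] exI[of _ p2] exI[of _ p3])
  have "pos (q, 0) = p + u * of_real (of_int q / S)" by (simp add: pos_def complex_eq_iff)
  then have Q: "R (q, 0) (g x)" "R (q, 0) (g y)"
    using xy by (auto simp: R_def)
  \<comment> \<open>The bounds on \<open>q\<close> make \<open>(0, 0)\<close> and
    \<open>(q, 0)\<close> adjacent, so the three colours at one and the two colours at the other are
    five different colours.\<close>
  have far: "c \<noteq> d" if "R (0, 0) c" "R (q, 0) d" for c d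
  proof -
    have "s\<^sup>2 < q\<^sup>2" using q s by (intro power_strict_mono) auto
    then have "annulus_adj l m (0, 0) (q, 0)" using q by (simp add: annulus_adj_def l)
    then show ?thesis using edge that by blast
  qed
  \<comment> \<open>The same vertex may represent several classes because \<open>R\<close> relates
    it to each of the colours found nearby.\<close>
  have "realizes C R [[(0, 0)], [(0, 0)], [(0, 0)], [(q, 0)], [(q, 0)]] [g p, g p2, g p3, g x, g y]"
    using O Q p xy far gC by (auto simp: realizes_def)
  then have "\<not> card C \<le> k"
    using refutes_sound(1)[where R = R, OF C _ total _ cert] edge by blast
  then show "enat (Suc k) \<le> enat (card C)" by simp
qed

section \<open>Rational bounds for the five thresholds\<close>

lemma sin_approx_cubic: "\<bar>sin x - (x - x ^ 3 / 6)\<bar> \<le> \<bar>x\<bar> ^ 5 / 120" for x :: real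
proof -
  have "{..<5} = {0, 1, 2, 3, 4 :: nat}" by auto
  \<comment> \<open>The even coefficients vanish, so five terms of the series give the cubic with a
    remainder of order five.\<close>
  then have "(\<Sum>m<5. sin_coeff m * x ^ m) = x - x ^ 3 / 6"
    by (simp add: sin_coeff_def fact_numeral)
  then have "\<bar>sin x - (x - x ^ 3 / 6)\<bar> \<le> inverse (fact 5) * \<bar>x\<bar> ^ 5"
    using Maclaurin_sin_bound[of x 5] by (simp only:)
  also have "inverse (fact 5) * \<bar>x\<bar> ^ 5 = \<bar>x\<bar> ^ 5 / 120"
    by (simp add: fact_numeral)
  finally show ?thesis .
qed

text \<open>Lower bounds suffice, since \<open>b\<close> is assumed to exceed the thresholds. They
  serve as the rational radius \<open>b'\<close> of the finite searches, which thus take place in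
  slightly narrower annuli.\<close>

lemma threshold_bounds:
  "12859 / 10000 \<le> sqrt (2 - 2 * sin (18 * pi / 325))"
  "14705 / 10000 \<le> sqrt (2 + 2 * sin (pi / 38))"
  "1714 / 1000 \<le> sqrt (2 + 2 * sin (7 * pi / 45))"
  "18284 / 10000 \<le> 2 * sqrt 2 - 1"
  "201 / 100 \<le> 1 / 3 * (5 - sqrt 2 + sqrt 6)"
proof -
  have pi: "3.1415 \<le> pi" "pi \<le> 3.1416" using pi_approx by auto
  \<comment> \<open>The sine is subtracted here, so the angle and its sine are rounded up; in the
    next two cases both are rounded down.\<close>
  have "sin (18 * pi / 325) \<le> sin (0.174 :: real)"
    using pi by (intro sin_monotone_2pi_le) auto
  moreover have "sin (0.174 :: real) \<le> 0.1732"
    using sin_approx_cubic[of "0.174", unfolded abs_le_iff] by (simp add: power_divide)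
  ultimately show "12859 / 10000 \<le> sqrt (2 - 2 * sin (18 * pi / 325))"
    by (intro real_le_rsqrt) (simp add: power2_eq_square)
  have "sin (0.08267 :: real) \<le> sin (pi / 38)"
    using pi by (intro sin_monotone_2pi_le) auto
  moreover have "0.0812 \<le> sin (0.08267 :: real)"
    using sin_approx_cubic[of "0.08267", unfolded abs_le_iff] by (simp add: power_divide)
  ultimately show "14705 / 10000 \<le> sqrt (2 + 2 * sin (pi / 38))"
    by (intro real_le_rsqrt) (simp add: power2_eq_square)
  have "sin (0.48867 :: real) \<le> sin (7 * pi / 45)"
    using pi by (intro sin_monotone_2pi_le) auto
  moreover have "0.4689 \<le> sin (0.48867 :: real)"
    using sin_approx_cubic[of "0.48867", unfolded abs_le_iff] by (simp add: power_divide)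
  ultimately show "1714 / 1000 \<le> sqrt (2 + 2 * sin (7 * pi / 45))"
    by (intro real_le_rsqrt) (simp add: power2_eq_square)
  have s2: "14142 / 10000 \<le> sqrt 2" "sqrt 2 \<le> 141422 / 100000"
    by (rule real_le_rsqrt real_le_lsqrt; simp add: power2_eq_square)+
  have s6: "24494 / 10000 \<le> sqrt 6"
    by (rule real_le_rsqrt) (simp add: power2_eq_square)
  show "18284 / 10000 \<le> 2 * sqrt 2 - 1" using s2 by linarith
  \<comment> \<open>With variables in place of the roots the estimate is purely linear.\<close>
  have "201 / 100 \<le> 1 / 3 * (5 - x + y)" if "x \<le> 141422 / 100000" "24494 / 10000 \<le> y" for x y :: real
    using that by (simp add: field_simps)
  then show "201 / 100 \<le> 1 / 3 * (5 - sqrt 2 + sqrt 6)" using s2(2) s6 by blast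
qed

subsection \<open>Certificates for finite subgraphs of annuli\<close>

text \<open>
  The points lie close to regular polygons on a few concentric circles. They were found by a
  computer search that minimized the number of nodes of the search tree.
\<close>

lemma refutes_6_colors:
  "refutes 6 (annulus_adj 10000000000 16535388100) (
  Branch (17365, -98482) [Branch (17365, 98482) [Branch (50001, 86604) [Branch (50001, -86604) [
  Branch (-76605, 64280) [Branch (-93970, -34202) [Branch (-50001, 86604) [
  Branch (-76605, -64280) [Branch (-93970, 34202) [Branch (-50001, -86604) [Branch (-100001, 0) [
  Branch (-17365, -98482) [Branch (76605, -64280) [Branch (93970, -34202) [
  Branch (76605, 64280) []]]]]]]]]], Branch (-93970, -34202) [Branch (-50001, 86604) [
  Branch (-76605, -64280) [Branch (-93970, 34202) [Branch (-50001, -86604) [Branch (-100001, 0) [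
  Branch (-17365, -98482) [Branch (76605, -64280) [Branch (93970, -34202) [
  Branch (76605, 64280) []]]]]]]]]]]]]]])
  [[(0, 0)], [(0, 0)], [(0, 0)], [(100003, 0)], [(100003, 0)]]"
  \<comment> \<open>The scale is 100000, and 16535388100 is the square of 128590. The branching
    vertices are rounded vertices of a regular 18-gon about the origin with radius just above 1
    after scaling. Edges among them can only come from chords of 60 and 80 degrees; the latter have
    length about 1.2856, just below 1.2859.\<close>
  by code_simp

text \<open>The scale is 1000, and 2162370 is the integer part of the square of 1470.5. The first
  vertex is adjacent to both starting points and therefore needs a sixth colour.\<close>

lemma refutes_7_colors:
  "refutes 7 (annulus_adj 1000000 2162370) (
  Branch (-70, 999) [Branch (1075, 1002) [Branch (70, 999) [Branch (944, 1126) [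
  Branch (-70, -999) [Branch (1075, -1002) [Branch (925, -1142) [Branch (70, -999) [
  Branch (501, -867) [Branch (501, 867) [Branch (-501, 867) [Branch (900, 439) [
  Branch (830, -560) [Branch (-516, -858) [Branch (-331, -1432) [Branch (-840, -545) [
  Branch (-892, 455) [Branch (-1173, -884) [Branch (-995, 113) [Branch (-1457, 192) [
  Branch (-293, 957) []]]]]]]], Branch (840, 545) [Branch (892, -455) [Branch (-516, -858) [
  Branch (-331, 1432) [Branch (-892, 455) [Branch (-840, -545) [Branch (-1196, 853) [
  Branch (-991, -139) [Branch (-1453, -217) [Branch (-359, -935) []]]]]]]]]]]],
  Branch (900, 439) [Branch (830, -560) [Branch (-516, -858) [Branch (-331, -1432) [
  Branch (-840, -545) [Branch (-892, 455) [Branch (-1173, -884) [Branch (-995, 113) [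
  Branch (-1457, 192) [Branch (-293, 957) []]]]]]]], Branch (840, 545) [Branch (892, -455) [
  Branch (-516, -858) [Branch (-331, 1432) [Branch (-892, 455) [Branch (-840, -545) [
  Branch (-1196, 853) [Branch (-991, -139) [Branch (-1453, -217) [Branch (-359, -935) []]]]]]]]]]]
  ]], Branch (830, -560) [Branch (-516, -858) [Branch (-892, 455) [Branch (-331, -1432) [
  Branch (900, 439) [Branch (141, 1463) [Branch (-1173, -884) [Branch (-995, 113) [
  Branch (-815, 581) [Branch (-293, 957) [Branch (-1457, 192) [Branch (-501, 867) [
  Branch (-609, 794) [Branch (840, 545) [Branch (355, 1426) []]]]]]]]]]]]]], Branch (-516, -858) [
  Branch (-892, 455) [Branch (-331, -1432) [Branch (900, 439) [Branch (141, 1463) [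
  Branch (-1173, -884) [Branch (-995, 113) [Branch (-815, 581) [Branch (-293, 957) [
  Branch (-1457, 192) [Branch (-501, 867) [Branch (-609, 794) [Branch (840, 545) [
  Branch (355, 1426) []]]]]]]]]]]]]]]], Branch (-840, -545) [Branch (501, 867) [
  Branch (-501, 867) [Branch (840, 545) [Branch (892, -455) [Branch (179, -1458) [
  Branch (-331, 1432) [Branch (-1196, 853) [Branch (-991, -139) [Branch (-359, -935) [
  Branch (-1453, -217) [Branch (-623, -784) [Branch (830, -560) [Branch (-516, -858) [
  Branch (318, -1434) []]]]]]]]]]]]], Branch (-892, 455) [Branch (830, -560) [
  Branch (-623, -784) [Branch (840, 545) [Branch (-501, 867) [Branch (-609, 794) [
  Branch (-750, -663) [Branch (695, -720) [Branch (663, 750) [Branch (-784, 623) []]]]]]]],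
  Branch (840, 545) [Branch (-331, -1432) [Branch (141, 1463) [Branch (-609, 794) [
  Branch (179, -1458) [Branch (-623, -784) [Branch (-331, 1432) [Branch (1412, 405) [
  Branch (516, 858) [Branch (815, -581) [Branch (-896, -447) [Branch (-393, -1416) [
  Branch (470, -884) [Branch (-918, -399) [Branch (-991, -139) [Branch (-925, -1142) [
  Branch (-947, 326) [Branch (399, 918) [Branch (-490, 1385) [Branch (773, 637) [
  Branch (581, -815) [Branch (-832, -1211) []]]]]]], Branch (217, -977) [Branch (1445, -268) [
  Branch (581, -815) [Branch (773, 637) [Branch (-490, 1385) [Branch (399, 918) [
  Branch (-947, 326) [Branch (-925, -1142) [Branch (1457, -192) [Branch (637, -773) [
  Branch (-1011, 1066) [Branch (-999, 61) [Branch (139, 991) [Branch (720, 695) [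
  Branch (1432, 331) [Branch (560, 830) [Branch (784, -623) [Branch (-466, -1393) [
  Branch (415, -911) [Branch (-938, -351) [Branch (-954, 1117) [Branch (-995, 113) [
  Branch (182, 984) [Branch (1449, 243) [Branch (609, 794) [Branch (744, -670) [
  Branch (1469, 26) [Branch (326, 947) [Branch (-969, 251) [Branch (-832, -1211) [
  Branch (-977, -217) [Branch (293, -957) [Branch (-644, -1321) [Branch (695, -720) [
  Branch (663, 750) [Branch (359, -935) [Branch (-957, -293) [Branch (-884, 1173) [
  Branch (-986, 174) [Branch (251, 969) [Branch (1463, 141) []]]]]]]]]]]]]]]]]]]]]]]]]]]]]]]]]]]]]
  ]]]]]]]]]]]]]]]]]]]]]], Branch (501, 867) [Branch (-501, 867) [Branch (840, 545) [
  Branch (892, -455) [Branch (179, -1458) [Branch (-331, 1432) [Branch (-1196, 853) [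
  Branch (-991, -139) [Branch (-359, -935) [Branch (-1453, -217) [Branch (-623, -784) [
  Branch (830, -560) [Branch (-516, -858) [Branch (318, -1434) []]]]]]]]]]]]],
  Branch (-892, 455) [Branch (830, -560) [Branch (840, 545) [Branch (-331, -1432) [
  Branch (141, 1463) [Branch (-609, 794) [Branch (179, -1458) [Branch (-623, -784) [
  Branch (-331, 1432) [Branch (1412, 405) [Branch (516, 858) [Branch (815, -581) [
  Branch (-896, -447) [Branch (-393, -1416) [Branch (470, -884) [Branch (-918, -399) [
  Branch (-991, -139) [Branch (-925, -1142) [Branch (-947, 326) [Branch (399, 918) [
  Branch (-490, 1385) [Branch (773, 637) [Branch (581, -815) [Branch (-832, -1211) []]]]]]],
  Branch (217, -977) [Branch (1445, -268) [Branch (581, -815) [Branch (773, 637) [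
  Branch (-490, 1385) [Branch (399, 918) [Branch (-947, 326) [Branch (-925, -1142) [
  Branch (1457, -192) [Branch (637, -773) [Branch (-1011, 1066) [Branch (-999, 61) [
  Branch (139, 991) [Branch (720, 695) [Branch (1432, 331) [Branch (560, 830) [
  Branch (784, -623) [Branch (-466, -1393) [Branch (415, -911) [Branch (-938, -351) [
  Branch (-954, 1117) [Branch (-995, 113) [Branch (182, 984) [Branch (1449, 243) [
  Branch (609, 794) [Branch (744, -670) [Branch (1469, 26) [Branch (326, 947) [
  Branch (-969, 251) [Branch (-832, -1211) [Branch (-977, -217) [Branch (293, -957) [
  Branch (-644, -1321) [Branch (695, -720) [Branch (663, 750) [Branch (359, -935) [
  Branch (-957, -293) [Branch (-884, 1173) [Branch (-986, 174) [Branch (251, 969) [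
  Branch (1463, 141) []]]]]]]]]]]]]]]]]]]]]]]]]]]]]]]]]]]]]]]]]]]]]]]]]]]]]]]],
  Branch (-623, -784) [Branch (840, 545) [Branch (-501, 867) [Branch (-609, 794) [
  Branch (-750, -663) [Branch (695, -720) [Branch (663, 750) [Branch (-784, 623) []]]]]]]]]]]]]]]
  ], Branch (1075, -1002) [Branch (925, -1142) [Branch (70, -999) [Branch (-991, -139) [
  Branch (501, -867) [Branch (-925, -1142) [Branch (-990, 148) [Branch (-840, -545) [
  Branch (179, -1458) [Branch (-623, -784) [Branch (-892, 455) [Branch (501, 867) [
  Branch (830, -560) [Branch (-501, 867) [Branch (840, 545) [Branch (-609, 794) [
  Branch (-750, -663) [Branch (695, -720) [Branch (663, 750) [Branch (-784, 623) []]]]]]]]]]]],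
  Branch (-501, 867) [Branch (501, 867) [Branch (-892, 455) [Branch (-609, 794) [
  Branch (141, 1463) [Branch (-944, 1126) []]]]]]]]], Branch (-331, -1432) [Branch (830, -560) [
  Branch (840, 545) [Branch (-501, 867) [Branch (-840, -545) [Branch (501, 867) [
  Branch (-892, 455) [Branch (-516, -858) []]]]]], Branch (501, 867) [Branch (-944, 1126) [
  Branch (-995, 113) [Branch (-516, -858) [Branch (-892, 455) [Branch (-840, -545) [
  Branch (-501, 867) [Branch (-623, -784) [Branch (-609, 794) [Branch (-750, -663) [
  Branch (840, 545) [Branch (695, -720) [Branch (663, 750) [Branch (-784, 623) []]]]]]]]]]]]]]]]
  ], Branch (501, -867) [Branch (-925, -1142) [Branch (-990, 148) [Branch (-840, -545) [
  Branch (-501, 867) [Branch (501, 867) [Branch (-892, 455) [Branch (-609, 794) [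
  Branch (141, 1463) [Branch (-944, 1126) []]]]]], Branch (179, -1458) [Branch (-623, -784) [
  Branch (-892, 455) [Branch (501, 867) [Branch (830, -560) [Branch (-501, 867) [
  Branch (840, 545) [Branch (-609, 794) [Branch (-750, -663) [Branch (695, -720) [
  Branch (663, 750) [Branch (-784, 623) []]]]]]]]]]]]]]], Branch (-331, -1432) [
  Branch (830, -560) [Branch (840, 545) [Branch (-501, 867) [Branch (-840, -545) [
  Branch (501, 867) [Branch (-892, 455) [Branch (-516, -858) []]]]]], Branch (501, 867) [
  Branch (-944, 1126) [Branch (-995, 113) [Branch (-516, -858) [Branch (-892, 455) [
  Branch (-840, -545) [Branch (-501, 867) [Branch (-623, -784) [Branch (-609, 794) [
  Branch (-750, -663) [Branch (840, 545) [Branch (695, -720) [Branch (663, 750) [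
  Branch (-784, 623) []]]]]]]]]]]]]]]]]]]]]]]]]])
  [[(0, 0)], [(0, 0)], [(0, 0)], [(1003, 0)], [(1003, 0)]]"
  by code_simp

text \<open>The scale is 1000, and 2937796 is the square of 1714. Again the first vertex sees both
  starting points, which forces a sixth colour.\<close>

lemma refutes_8_colors:
  "refutes 8 (annulus_adj 1000000 2937796) (
  Branch (-131, -993) [Branch (1460, -895) [Branch (697, -1565) [Branch (-234, -974) [
  Branch (529, -1629) [Branch (761, -650) [Branch (761, 650) [Branch (1460, 895) [
  Branch (1692, -268) [Branch (455, 892) [Branch (1692, 268) [Branch (588, -810) [
  Branch (455, -892) [Branch (588, 810) [Branch (1179, 1242) [Branch (157, 989) [
  Branch (1350, -142) []]]]]]]]], Branch (1692, -268) [Branch (455, -892) [Branch (455, 892) [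
  Branch (1692, 268) [Branch (697, 1565) [Branch (-131, 993) [Branch (157, 989) [
  Branch (1179, 1242) [Branch (-455, 892) [Branch (234, -974) [Branch (1211, -1211) [
  Branch (-455, -892) [Branch (588, -810) [Branch (1350, -142) [Branch (726, 689) [
  Branch (908, -1008) [Branch (134, -1708) [Branch (-689, -726) [Branch (-925, -383) [
  Branch (-1007, -1386) [Branch (-52, -1000) [Branch (817, -1505) []]]]]]]]], Branch (588, 810) [
  Branch (-689, -726) [Branch (-925, -383) [Branch (1350, 142) [Branch (726, -689) [
  Branch (908, 1008) [Branch (134, 1708) [Branch (-609, 794) [Branch (-1112, 1302) [
  Branch (-952, 309) [Branch (-1007, -1386) [Branch (-1654, -443) [Branch (-52, -1000) []]]]]]]]]]
  ]]]]]]]]]]]]]]]], Branch (697, 1565) [Branch (1692, 268) [Branch (455, -892) [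
  Branch (1692, -268) [Branch (908, -1008) []]]], Branch (-131, 993) [Branch (455, -892) [
  Branch (1692, -268) [Branch (1179, 1242) [Branch (1692, 268) []]], Branch (1692, 268) [
  Branch (455, 892) [Branch (1692, -268) [Branch (157, 989) [Branch (1179, 1242) [
  Branch (-455, 892) [Branch (234, -974) [Branch (1211, -1211) [Branch (-455, -892) [
  Branch (157, -989) [Branch (588, -810) [Branch (-974, -234) [Branch (1350, -142) [
  Branch (726, 689) [Branch (908, -1008) [Branch (134, -1708) [Branch (-689, -726) [
  Branch (-925, -383) [Branch (-1007, -1386) [Branch (-52, -1000) [Branch (817, -1505) []]]]]]]]]
  ], Branch (134, -1708) [Branch (-689, -726) [Branch (-925, -383) [Branch (817, -1505) [
  Branch (-52, -1000) [Branch (-1007, -1386) [Branch (-952, 309) [Branch (588, 810) [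
  Branch (-1654, -443) [Branch (-609, 794) [Branch (134, 1708) []]]]]]]]]]]]]]]]]]]]]]]]]],
  Branch (455, -892) [Branch (234, -974) [Branch (1211, -1211) [Branch (1692, -268) [
  Branch (-455, -892) [Branch (925, 383) [Branch (-52, -1000) [Branch (817, -1505) [
  Branch (944, 334) [Branch (1675, -356) [Branch (588, -810) [Branch (-925, -383) [
  Branch (-356, -1675) [Branch (-689, -726) [Branch (-952, 309) [Branch (-1654, -443) [
  Branch (-1078, -1331) [Branch (-974, -234) [Branch (-609, 794) [Branch (697, 1565) [
  Branch (455, 892) [Branch (1460, 895) [Branch (-131, 993) []]]]]]]], Branch (-1654, -443) [
  Branch (-131, 993) [Branch (697, 1565) [Branch (1460, 895) [Branch (455, 892) [
  Branch (-609, 794) []]]]]]]]]], Branch (134, -1708) [Branch (-689, -726) [Branch (-925, -383) [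
  Branch (-455, 892) [Branch (697, 1565) [Branch (-356, -1675) [Branch (-131, 993) [
  Branch (1460, 895) [Branch (726, -689) [Branch (284, 960) [Branch (-984, -182) [
  Branch (-1007, -1386) [Branch (0, -1357) [Branch (744, -670) [Branch (-935, -359) [
  Branch (-1043, -1359) [Branch (-36, -1357) []]]]]]]]]]]]]]]]]]]]]]]]]]]], Branch (455, -892) [
  Branch (908, -1008) [Branch (-689, -726) [Branch (-356, -1675) []]]]], Branch (761, 650) [
  Branch (455, -892) [Branch (1692, -268) [Branch (1692, 268) [Branch (908, -1008) []]],
  Branch (1692, 268) [Branch (697, 1565) [Branch (1460, 895) [Branch (1692, -268) [
  Branch (1179, 1242) [Branch (-131, 993) []]], Branch (455, 892) [Branch (1692, -268) [
  Branch (157, 989) [Branch (1179, 1242) [Branch (-455, 892) [Branch (234, -974) [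
  Branch (1211, -1211) [Branch (-455, -892) [Branch (157, -989) [Branch (588, -810) [
  Branch (-974, -234) [Branch (1350, -142) [Branch (726, 689) [Branch (908, -1008) [
  Branch (134, -1708) [Branch (-689, -726) [Branch (-925, -383) [Branch (-1007, -1386) [
  Branch (-52, -1000) [Branch (817, -1505) []]]]]]]]]], Branch (134, -1708) [Branch (-689, -726) [
  Branch (-925, -383) [Branch (817, -1505) [Branch (-52, -1000) [Branch (-1007, -1386) [
  Branch (-952, 309) [Branch (588, 810) [Branch (-1654, -443) [Branch (-609, 794) [
  Branch (134, 1708) []]]]]]]]]]]]]]]]]]]]]], Branch (1460, 895) [Branch (1692, -268) [
  Branch (588, 810) [Branch (455, 892) [Branch (588, -810) [Branch (1179, 1242) [
  Branch (157, 989) [Branch (1350, -142) []]]]]]], Branch (455, 892) [Branch (1692, -268) [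
  Branch (-131, 993) [Branch (157, 989) [Branch (1179, 1242) [Branch (-455, 892) [
  Branch (234, -974) [Branch (1211, -1211) [Branch (-455, -892) [Branch (588, -810) [
  Branch (1350, -142) [Branch (726, 689) [Branch (908, -1008) [Branch (134, -1708) [
  Branch (-689, -726) [Branch (-925, -383) [Branch (-1007, -1386) [Branch (-52, -1000) [
  Branch (817, -1505) []]]]]]]]], Branch (588, 810) [Branch (-689, -726) [Branch (-925, -383) [
  Branch (1350, 142) [Branch (726, -689) [Branch (908, 1008) [Branch (134, 1708) [
  Branch (-609, 794) [Branch (-1112, 1302) [Branch (-952, 309) [Branch (-1007, -1386) [
  Branch (-52, -1000) [Branch (-1654, -443) []]]]]]]]]]]]]]]]]]]]]]]]]]], Branch (455, -892) [
  Branch (234, -974) [Branch (1211, -1211) [Branch (1692, -268) [Branch (-455, -892) [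
  Branch (925, 383) [Branch (-52, -1000) [Branch (817, -1505) [Branch (944, 334) [
  Branch (1675, -356) [Branch (588, -810) [Branch (-925, -383) [Branch (-356, -1675) [
  Branch (-689, -726) [Branch (-952, 309) [Branch (-1654, -443) [Branch (-1078, -1331) [
  Branch (-974, -234) [Branch (-609, 794) [Branch (697, 1565) [Branch (455, 892) [
  Branch (1460, 895) [Branch (-131, 993) []]]]]]]], Branch (-1654, -443) [Branch (-131, 993) [
  Branch (697, 1565) [Branch (1460, 895) [Branch (455, 892) [Branch (-609, 794) []]]]]]]]]],
  Branch (134, -1708) [Branch (-689, -726) [Branch (-925, -383) [Branch (-455, 892) [
  Branch (697, 1565) [Branch (-356, -1675) [Branch (-131, 993) [Branch (1460, 895) [
  Branch (726, -689) [Branch (284, 960) [Branch (-984, -182) [Branch (-1007, -1386) [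
  Branch (0, -1357) [Branch (744, -670) [Branch (-935, -359) [Branch (-1043, -1359) [
  Branch (-36, -1357) []]]]]]]]]]]]]]]]]]]]]]]]]]]], Branch (455, -892) [Branch (908, -1008) [
  Branch (-689, -726) [Branch (-356, -1675) []]]]], Branch (-455, -892) [Branch (486, -1267) [
  Branch (1460, 895) [Branch (455, 892) [Branch (697, 1565) [Branch (-131, 993) [
  Branch (908, 1008) [Branch (-455, 892) [Branch (486, 1267) [Branch (-925, -383) [
  Branch (-609, 794) [Branch (-486, 1267) [Branch (-935, 359) [Branch (-689, -726) [
  Branch (-356, -1675) [Branch (588, -810) [Branch (-1118, -769) []]]]]]], Branch (-609, 794) [
  Branch (-486, 1267) [Branch (-935, 359) [Branch (-689, -726) [Branch (-356, -1675) [
  Branch (588, -810) [Branch (-1118, -769) []]]]]]]]]]]], Branch (-131, 993) [Branch (-952, 309) [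
  Branch (-689, -726) [Branch (-1193, 648) [Branch (-925, -383) [Branch (-944, -334) [
  Branch (-1078, -1331) [Branch (-1654, -443) [Branch (-52, -1000) [Branch (-1007, -1386) [
  Branch (588, -810) [Branch (1692, -268) [Branch (925, 383) []]]]]]]]]], Branch (455, -892) [
  Branch (-925, -383) [Branch (-356, -1675) [Branch (588, -810) [Branch (-1118, -769) []]],
  Branch (-356, -1675) [Branch (-974, -234) [Branch (-1078, -1331) [Branch (-1112, 1302) [
  Branch (501, 867) [Branch (545, -840) []]]]]]]]], Branch (-689, -726) [Branch (-1193, 648) [
  Branch (-925, -383) [Branch (-944, -334) [Branch (-1078, -1331) [Branch (-1654, -443) [
  Branch (-52, -1000) [Branch (-1007, -1386) [Branch (588, -810) [Branch (1692, -268) [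
  Branch (925, 383) []]]]]]]]]], Branch (455, -892) [Branch (-925, -383) [Branch (-356, -1675) [
  Branch (-974, -234) [Branch (-1078, -1331) [Branch (-1112, 1302) [Branch (501, 867) [
  Branch (545, -840) []]]]]], Branch (-356, -1675) [Branch (588, -810) [Branch (-1118, -769) []]]]
  ]]]]]], Branch (455, 892) [Branch (697, 1565) [Branch (-131, 993) [Branch (-234, 974) [
  Branch (529, 1629) [Branch (455, -892) [Branch (-689, -726) [Branch (-356, -1675) [
  Branch (-925, -383) [Branch (944, -334) [Branch (134, -1708) [Branch (588, -810) [
  Branch (-1007, -1386) [Branch (-952, 309) [Branch (588, 810) [Branch (1675, 356) [
  Branch (1179, 1242) [Branch (157, 989) [Branch (854, -523) []]]]]]]]]]]], Branch (-356, -1675) [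
  Branch (-925, -383) [Branch (944, -334) [Branch (134, -1708) [Branch (588, -810) [
  Branch (-1007, -1386) [Branch (-952, 309) [Branch (588, 810) [Branch (1675, 356) [
  Branch (1179, 1242) [Branch (157, 989) [Branch (854, -523) []]]]]]]]]]]]], Branch (761, 650) [
  Branch (1692, 268) [Branch (925, -383) [Branch (157, 989) [Branch (1179, 1242) [
  Branch (-455, 892) [Branch (944, -334) [Branch (1675, 356) [Branch (588, 810) [
  Branch (134, 1708) [Branch (726, 689) [Branch (1007, -1386) [Branch (0, -1357) [
  Branch (309, -952) [Branch (-79, 998) [Branch (778, 1526) [Branch (-650, 761) [
  Branch (-268, 1692) [Branch (-989, 157) [Branch (-1112, 1302) [Branch (-952, 309) [
  Branch (-726, -689) [Branch (36, -1357) [Branch (1043, -1359) [Branch (935, -359) [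
  Branch (-744, -670) []]]]]]]]]]]]]]]]]]]]]]]]], Branch (1692, 268) [Branch (925, -383) [
  Branch (157, 989) [Branch (1179, 1242) [Branch (-455, 892) [Branch (944, -334) [
  Branch (1675, 356) [Branch (588, 810) [Branch (134, 1708) [Branch (726, 689) [
  Branch (1007, -1386) [Branch (0, -1357) [Branch (309, -952) [Branch (-79, 998) [
  Branch (778, 1526) [Branch (-650, 761) [Branch (-268, 1692) [Branch (-989, 157) [
  Branch (-1112, 1302) [Branch (-952, 309) [Branch (-726, -689) [Branch (36, -1357) [
  Branch (1043, -1359) [Branch (935, -359) [Branch (-744, -670) []]]]]]]]]]]]]]]]]]]]]]]]]]]]]],
  Branch (-131, 993) [Branch (908, 1008) [Branch (-455, 892) [Branch (486, 1267) [
  Branch (-689, -726) [Branch (-609, 794) [Branch (-925, -383) [Branch (925, -383) [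
  Branch (1692, 268) [Branch (588, 810) [Branch (-935, 359) [Branch (-486, 1267) []]]]]]],
  Branch (-609, 794) [Branch (-925, -383) [Branch (925, -383) [Branch (1692, 268) [
  Branch (588, 810) [Branch (-935, 359) [Branch (-486, 1267) []]]]]]]]]]]]]]]]]]]]]]])
  [[(0, 0)], [(0, 0)], [(0, 0)], [(1003, 0)], [(1003, 0)]]"
  by code_simp

text \<open>The finer scale 10000 is used, and 334304656 is the square of 18284.\<close>

lemma refutes_9_colors:
  "refutes 9 (annulus_adj 100000000 334304656) (
  Branch (-1045, -9946) [Branch (10224, -15157) [Branch (16702, -7436) [Branch (18105, -2544) [
  Branch (6692, -7432) [Branch (9614, 2757) [Branch (1737, -9849) [Branch (6692, 7432) [
  Branch (-6692, 7432) [Branch (4384, -8989) [Branch (5039, 17575) [Branch (16702, 7436) [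
  Branch (4068, 9137) [Branch (13587, 12234) [Branch (-3421, 9398) []]]]]]],
  Branch (16702, 7436) [Branch (-6692, 7432) [Branch (5039, 17575) [Branch (-1392, 9904) [
  Branch (10224, 15157) [Branch (13587, 12234) [Branch (0, 15177) []]]]], Branch (5039, 17575) [
  Branch (-1392, 9904) [Branch (10224, 15157) [Branch (13587, 12234) [Branch (0, 15177) []]]]]],
  Branch (11454, -9957) [Branch (-3421, -9398) [Branch (6429, -7661) [Branch (6429, 7661) [
  Branch (6750, -10008) [Branch (-4384, -8989) [Branch (5539, -11879) [Branch (-1392, 9904) [
  Branch (5039, 17575) [Branch (13587, 12234) [Branch (-4384, 8989) []]], Branch (5039, 17575) [
  Branch (16403, 5330) [Branch (16403, -5330) [Branch (17575, -5039) [Branch (12234, -13587) [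
  Branch (3091, -9512) [Branch (-6692, -7432) [Branch (5001, 8661) [Branch (-4423, -17740) [
  Branch (-9783, -2079) []]]]]]]]]]]]]]]]]]]]]], Branch (16702, 7436) [Branch (6692, 7432) [
  Branch (8481, -5300) [Branch (0, -15177) [Branch (-6692, -7432) [Branch (-6429, -7661) [
  Branch (5650, -17388) []]]], Branch (0, -15177) [Branch (-6692, -7432) [Branch (5650, -17388) []
  ]]], Branch (11454, -9957) [Branch (0, -15177) [Branch (-6429, -7661) [Branch (5650, -17388) [
  Branch (-6692, -7432) [Branch (8481, -5300) [Branch (-6692, 7432) [Branch (-1392, 9904) [
  Branch (8481, 5300) [Branch (10224, 15157) [Branch (1392, 9904) [Branch (9614, 2757) [
  Branch (9111, -7920) []]]]]]]]]]]]]], Branch (8481, -5300) [Branch (6692, 7432) [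
  Branch (11454, -9957) [Branch (0, -15177) [Branch (-6429, -7661) [Branch (-6692, 7432) [
  Branch (-6692, -7432) [Branch (5650, -17388) []]]]]]], Branch (0, -15177) [
  Branch (-6692, -7432) [Branch (-6429, -7661) [Branch (5650, -17388) []]]]]],
  Branch (5650, -17388) [Branch (8481, -5300) [Branch (8481, 5300) [Branch (1737, -9849) [
  Branch (6692, 7432) [Branch (16702, 7436) [Branch (6429, 7661) [Branch (16432, 8015) [
  Branch (-6692, 7432) [Branch (5039, 17575) [Branch (-1392, 9904) [Branch (10224, 15157) [
  Branch (0, 15177) []]]], Branch (5039, 17575) [Branch (-1392, 9904) [Branch (10224, 15157) [
  Branch (0, 15177) []]]]]]]]]]], Branch (-6692, -7432) [Branch (16702, 7436) [
  Branch (1392, 9904) [Branch (4068, 9137) [Branch (4384, -8989) [Branch (14005, -11752) [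
  Branch (13116, 9529) [Branch (1045, 9946) [Branch (11279, 10156) [Branch (18105, 2544) [
  Branch (9614, -2757) [Branch (6692, 7432) [Branch (-6692, 7432) [Branch (5039, 17575) [
  Branch (-5001, 8661) [Branch (10224, 15157) [Branch (0, 15177) []]]], Branch (5039, 17575) [
  Branch (-5001, 8661) [Branch (10224, 15157) [Branch (0, 15177) []]]]]]], Branch (6692, 7432) [
  Branch (8481, 5300) [Branch (-1392, 9904) [Branch (5039, 17575) [Branch (-6692, 7432) [
  Branch (10224, 15157) [Branch (0, 15177) []]]]]]]]]]]]]]], Branch (-1392, 9904) [
  Branch (1392, 9904) [Branch (10224, 15157) [Branch (13587, 12234) [Branch (9688, 15505) [
  Branch (1045, 9946) [Branch (11279, 10156) [Branch (-6692, 7432) [Branch (0, 15177) [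
  Branch (6692, 7432) [Branch (18105, 2544) [Branch (9614, -2757) []]]]]]]]]]]]]]]],
  Branch (5650, -17388) [Branch (9614, 2757) [Branch (16702, 7436) [Branch (6692, 7432) [
  Branch (8481, -5300) [Branch (-6692, -7432) [Branch (0, -15177) []], Branch (-1392, -9904) [
  Branch (5039, -17575) [Branch (6429, -7661) [Branch (16432, -8015) [Branch (0, -15177) [
  Branch (-6692, -7432) [Branch (-1392, 9904) [Branch (13116, 9529) [Branch (-6692, 7432) [
  Branch (4068, 9137) [Branch (-10001, 0) [Branch (5001, 8661) [Branch (16403, -5330) [
  Branch (3091, 9512) [Branch (-3291, 16931) [Branch (10224, 15157) [Branch (1392, 9904) [
  Branch (17575, 5039) [Branch (12234, 13587) []]]]]]]]]], Branch (5039, 17575) [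
  Branch (13587, 12234) [Branch (9688, 15505) [Branch (1392, 9904) [Branch (18105, 2544) [
  Branch (9614, -2757) [Branch (-3421, 9398) [Branch (3586, 16871) [Branch (6750, 10008) [
  Branch (16403, -5330) [Branch (17575, 5039) [Branch (12234, 13587) [Branch (1695, 16124) [
  Branch (-5001, 8661) [Branch (9783, -2079) [Branch (17883, 3801) [Branch (13152, 12700) []]]]]]]
  ]]]]]]]]]]]]]]]]]]]], Branch (6429, -7661) [Branch (16432, -8015) [Branch (0, -15177) [
  Branch (-6692, -7432) [Branch (-6692, 7432) [Branch (5039, 17575) [Branch (-1392, -9904) [
  Branch (-6429, 7661) [Branch (8481, -5300) [Branch (8481, 5300) [Branch (-1392, 9904) [
  Branch (10224, 15157) [Branch (1392, 9904) [Branch (13587, 12234) [Branch (0, 15177) []]]]]],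
  Branch (-1392, 9904) [Branch (10224, 15157) [Branch (13587, 12234) [Branch (0, 15177) []]]]]]]]]
  ]]]]], Branch (6692, 7432) [Branch (8481, -5300) [Branch (-6692, -7432) [Branch (0, -15177) []
  ], Branch (-6692, -7432) [Branch (0, -15177) [Branch (6429, -7661) [Branch (16432, -8015) []]],
  Branch (-1392, 9904) [Branch (-6429, -7661) [Branch (11454, -9957) [Branch (13116, 9529) [
  Branch (1045, -9946) [Branch (-6692, 7432) [Branch (11279, 10156) [Branch (1045, 9946) [
  Branch (17575, -5039) [Branch (17575, 5039) [Branch (18105, 2544) [Branch (9614, -2757) [
  Branch (14005, -11752) [Branch (-3421, -9398) [Branch (-5001, 8661) [Branch (-3421, 9398) [
  Branch (3586, 16871) []]]]]], Branch (1392, 9904) [Branch (10224, 15157) [Branch (-5001, 8661) [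
  Branch (1695, 16124) [Branch (12234, 13587) []]]]], Branch (13587, 12234) [
  Branch (5039, 17575) [Branch (4068, 9137) [Branch (4384, -8989) [Branch (14005, -11752) [
  Branch (-5001, 8661) [Branch (-3421, -9398) []]]]]]]]]]]], Branch (5039, 17575) [
  Branch (13587, 12234) [Branch (9688, 15505) [Branch (1392, 9904) [Branch (18105, 2544) [
  Branch (9614, -2757) [Branch (14005, -11752) [Branch (-3421, -9398) [Branch (-5001, 8661) [
  Branch (-3421, 9398) [Branch (-5001, -8661) [Branch (12234, -13587) [Branch (9783, -2079) [
  Branch (17883, 3801) []]]]]]]]]]]]]]]]]]]]]], Branch (1737, -9849) [Branch (14005, -11752) [
  Branch (0, -15177) [Branch (-6692, -7432) [Branch (1045, -9946) [Branch (11454, -9957) [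
  Branch (-6429, -7661) [Branch (-1392, 9904) [Branch (8481, -5300) [Branch (8481, 5300) [
  Branch (11279, -10156) []]]]]]]]]]]]]]]], Branch (6692, -7432) [Branch (9614, 2757) [
  Branch (1737, -9849) [Branch (6692, 7432) [Branch (4384, -8989) [Branch (-6692, 7432) [
  Branch (5039, 17575) [Branch (16702, 7436) [Branch (4068, 9137) [Branch (13587, 12234) [
  Branch (-3421, 9398) []]]]]]], Branch (16702, 7436) [Branch (-6692, 7432) [
  Branch (5039, 17575) [Branch (-1392, 9904) [Branch (10224, 15157) [Branch (13587, 12234) [
  Branch (0, 15177) []]]]], Branch (5039, 17575) [Branch (-1392, 9904) [Branch (10224, 15157) [
  Branch (13587, 12234) [Branch (0, 15177) []]]]]], Branch (11454, -9957) [Branch (-3421, -9398) [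
  Branch (6429, -7661) [Branch (6429, 7661) [Branch (6750, -10008) [Branch (-4384, -8989) [
  Branch (5539, -11879) [Branch (-1392, 9904) [Branch (5039, 17575) [Branch (13587, 12234) [
  Branch (-4384, 8989) []]], Branch (5039, 17575) [Branch (16403, 5330) [Branch (16403, -5330) [
  Branch (17575, -5039) [Branch (12234, -13587) [Branch (3091, -9512) [Branch (-6692, -7432) [
  Branch (5001, 8661) [Branch (-4423, -17740) [Branch (-9783, -2079) []]]]]]]]]]]]]]]]]]]]]],
  Branch (16702, 7436) [Branch (6692, 7432) [Branch (8481, -5300) [Branch (0, -15177) [
  Branch (-6692, -7432) [Branch (-6429, -7661) [Branch (5650, -17388) []]]], Branch (0, -15177) [
  Branch (-6692, -7432) [Branch (5650, -17388) []]]], Branch (11454, -9957) [Branch (0, -15177) [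
  Branch (-6429, -7661) [Branch (5650, -17388) [Branch (-6692, -7432) [Branch (8481, -5300) [
  Branch (-6692, 7432) [Branch (-1392, 9904) [Branch (8481, 5300) [Branch (10224, 15157) [
  Branch (1392, 9904) [Branch (9614, 2757) [Branch (9111, -7920) []]]]]]]]]]]]]],
  Branch (8481, -5300) [Branch (6692, 7432) [Branch (11454, -9957) [Branch (0, -15177) [
  Branch (-6429, -7661) [Branch (-6692, 7432) [Branch (-6692, -7432) [Branch (5650, -17388) []]]]]
  ]], Branch (0, -15177) [Branch (-6692, -7432) [Branch (-6429, -7661) [Branch (5650, -17388) []]]
  ]]], Branch (5650, -17388) [Branch (8481, -5300) [Branch (8481, 5300) [Branch (1737, -9849) [
  Branch (6692, 7432) [Branch (16702, 7436) [Branch (6429, 7661) [Branch (16432, 8015) [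
  Branch (-6692, 7432) [Branch (5039, 17575) [Branch (-1392, 9904) [Branch (10224, 15157) [
  Branch (0, 15177) []]]], Branch (5039, 17575) [Branch (-1392, 9904) [Branch (10224, 15157) [
  Branch (0, 15177) []]]]]]]]]]], Branch (-6692, -7432) [Branch (16702, 7436) [
  Branch (1392, 9904) [Branch (4068, 9137) [Branch (4384, -8989) [Branch (14005, -11752) [
  Branch (13116, 9529) [Branch (1045, 9946) [Branch (11279, 10156) [Branch (18105, 2544) [
  Branch (6692, 7432) [Branch (8481, 5300) [Branch (-1392, 9904) [Branch (5039, 17575) [
  Branch (-6692, 7432) [Branch (10224, 15157) [Branch (0, 15177) []]]]]]], Branch (9614, -2757) [
  Branch (6692, 7432) [Branch (-6692, 7432) [Branch (5039, 17575) [Branch (-5001, 8661) [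
  Branch (10224, 15157) [Branch (0, 15177) []]]], Branch (5039, 17575) [Branch (-5001, 8661) [
  Branch (10224, 15157) [Branch (0, 15177) []]]]]]]]]]]]]]], Branch (1392, 9904) [
  Branch (-1392, 9904) [Branch (10224, 15157) [Branch (13587, 12234) [Branch (9688, 15505) [
  Branch (1045, 9946) [Branch (11279, 10156) [Branch (-6692, 7432) [Branch (0, 15177) [
  Branch (6692, 7432) [Branch (18105, 2544) [Branch (9614, -2757) []]]]]]]]]]]]]]]],
  Branch (5650, -17388) [Branch (9614, 2757) [Branch (16702, 7436) [Branch (6692, 7432) [
  Branch (8481, -5300) [Branch (-6692, -7432) [Branch (0, -15177) []], Branch (-1392, -9904) [
  Branch (5039, -17575) [Branch (6429, -7661) [Branch (16432, -8015) [Branch (0, -15177) [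
  Branch (-6692, -7432) [Branch (-1392, 9904) [Branch (13116, 9529) [Branch (18105, 2544) [
  Branch (9614, -2757) [Branch (10224, 15157) [Branch (1392, 9904) [Branch (-3421, 9398) [
  Branch (6750, 10008) [Branch (16403, -5330) [Branch (17575, 5039) [Branch (12234, 13587) [
  Branch (3091, 9512) [Branch (-6692, 7432) [Branch (1695, 16124) [Branch (-5001, 8661) [
  Branch (3586, 16871) [Branch (9783, -2079) [Branch (17883, 3801) [Branch (13152, 12700) []]]]]]]
  ]]]]]]]]], Branch (13587, 12234) [Branch (5039, 17575) [Branch (-6692, 7432) [
  Branch (4068, 9137) []]]], Branch (1392, 9904) [Branch (-10001, 0) [Branch (4068, 9137) [
  Branch (10224, 15157) [Branch (9688, 15505) [Branch (-6692, 7432) [Branch (-3291, 16931) []]]]]]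
  ]]]]]]]]]]], Branch (6429, -7661) [Branch (16432, -8015) [Branch (0, -15177) [
  Branch (-6692, -7432) [Branch (-6692, 7432) [Branch (5039, 17575) [Branch (-1392, -9904) [
  Branch (-6429, 7661) [Branch (8481, -5300) [Branch (8481, 5300) [Branch (-1392, 9904) [
  Branch (10224, 15157) [Branch (1392, 9904) [Branch (13587, 12234) [Branch (0, 15177) []]]]]],
  Branch (-1392, 9904) [Branch (10224, 15157) [Branch (13587, 12234) [Branch (0, 15177) []]]]]]]]]
  ]]]]], Branch (6692, 7432) [Branch (8481, -5300) [Branch (-6692, -7432) [Branch (0, -15177) []
  ], Branch (-6692, -7432) [Branch (0, -15177) [Branch (6429, -7661) [Branch (16432, -8015) []]],
  Branch (-1392, 9904) [Branch (13116, 9529) [Branch (18105, 2544) [Branch (9614, -2757) [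
  Branch (14005, -11752) [Branch (10224, 15157) [Branch (1392, 9904) [Branch (-3421, -9398) [
  Branch (-5001, 8661) [Branch (-3421, 9398) [Branch (-5001, -8661) [Branch (12234, -13587) [
  Branch (9783, -2079) [Branch (17883, 3801) []]]]]]]]]]], Branch (1392, 9904) [
  Branch (10224, 15157) [Branch (9614, -2757) [Branch (-5001, 8661) [Branch (9688, 15505) [
  Branch (-6692, 7432) [Branch (11279, 10156) [Branch (1695, 16124) [Branch (12234, 13587) [
  Branch (17575, 5039) [Branch (1045, 9946) []]]]]]]]]]], Branch (13587, 12234) [
  Branch (5039, 17575) [Branch (4068, 9137) [Branch (4384, -8989) [Branch (14005, -11752) [
  Branch (-5001, 8661) [Branch (-3421, -9398) []]]]]]]]]]]], Branch (1737, -9849) [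
  Branch (14005, -11752) [Branch (0, -15177) [Branch (-6692, -7432) [Branch (1045, -9946) [
  Branch (11454, -9957) [Branch (-6429, -7661) [Branch (-1392, 9904) [Branch (8481, -5300) [
  Branch (8481, 5300) [Branch (11279, -10156) []]]]]]]]]]]]]]]], Branch (1737, -9849) [
  Branch (1392, -9904) [Branch (9688, -15505) [Branch (16702, 7436) [Branch (11454, -9957) [
  Branch (6692, 7432) [Branch (14142, 0) [Branch (6692, -7432) [Branch (0, -15177) [
  Branch (-6692, -7432) [Branch (4068, 9137) [Branch (9614, -2757) [Branch (-6429, -7661) [
  Branch (-1392, 9904) [Branch (13587, 12234) [Branch (18105, 2544) [Branch (1392, 9904) [
  Branch (10224, 15157) []]]]]]]]]]]], Branch (14142, 0) [Branch (6692, -7432) [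
  Branch (0, -15177) [Branch (-6692, -7432) [Branch (4068, 9137) [Branch (9614, -2757) [
  Branch (-6429, -7661) [Branch (-1392, 9904) [Branch (13587, 12234) [Branch (18105, 2544) [
  Branch (1392, 9904) [Branch (10224, 15157) []]]]]]]]]]]]]], Branch (4384, -8989) [
  Branch (14005, -11752) [Branch (5001, 8661) [Branch (8481, -5300) [Branch (6692, 7432) [
  Branch (-10001, 0) [Branch (6692, -7432) [Branch (5650, -17388) [Branch (13116, 9529) [
  Branch (-3421, -9398) [Branch (-5001, 8661) [Branch (16173, 1131) [Branch (1392, 9904) [
  Branch (10224, 15157) []]]]]]]]]], Branch (6692, 7432) [Branch (-10001, 0) [
  Branch (6692, -7432) [Branch (5650, -17388) [Branch (13116, 9529) [Branch (-3421, -9398) [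
  Branch (-5001, 8661) [Branch (16173, 1131) [Branch (1392, 9904) [Branch (10224, 15157) []]]]]]]]
  ]]]]], Branch (6692, -7432) [Branch (9614, 2757) [Branch (6692, 7432) [Branch (14142, 0) [
  Branch (14005, -11752) [Branch (18105, 2544) [Branch (1392, 9904) [Branch (10224, 15157) []]]]
  ], Branch (11454, -9957) [Branch (6429, -7661) [Branch (-6429, -7661) [Branch (16403, -5330) [
  Branch (5001, 8661) [Branch (-4423, -17740) [Branch (-9783, -2079) [Branch (-6692, 7432) [
  Branch (-1392, 9904) [Branch (11279, 10156) []]]]]]]]]]]], Branch (9614, 2757) [
  Branch (6692, 7432) [Branch (14142, 0) [Branch (14005, -11752) [Branch (18105, 2544) [
  Branch (1392, 9904) [Branch (10224, 15157) []]]]], Branch (11454, -9957) [Branch (6429, -7661) [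
  Branch (-6429, -7661) [Branch (16403, -5330) [Branch (5001, 8661) [Branch (-4423, -17740) [
  Branch (-9783, -2079) [Branch (-6692, 7432) [Branch (-1392, 9904) [Branch (11279, 10156) []]]]]]
  ]]]]]], Branch (13116, 9529) [Branch (5001, 8661) [Branch (8481, -5300) [Branch (6692, 7432) [
  Branch (18105, 2544) [Branch (1392, 9904) [Branch (10224, 15157) [Branch (-5001, 8661) [
  Branch (-6692, -7432) [Branch (15858, 3371) [Branch (-1045, 9946) []]]]]]]],
  Branch (6692, 7432) [Branch (18105, 2544) [Branch (1392, 9904) [Branch (10224, 15157) [
  Branch (-5001, 8661) [Branch (-6692, -7432) [Branch (15858, 3371) [Branch (-1045, 9946) []]]]]]]
  ]]]]]]]]]], Branch (14005, -11752) [Branch (5650, -17388) [Branch (8481, -5300) [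
  Branch (4384, -8989) [Branch (-6429, -7661) [Branch (18105, 2544) [Branch (8481, 5300) [
  Branch (-6692, 7432) [Branch (6692, 7432) [Branch (11454, -9957) [Branch (16702, 7436) [
  Branch (-1392, 9904) [Branch (4068, 9137) [Branch (10224, 15157) [Branch (13587, 12234) [
  Branch (0, 15177) []]]]]]]]]], Branch (11454, -9957) [Branch (6692, 7432) [Branch (4068, 9137) [
  Branch (13587, 12234) [Branch (5001, 8661) [Branch (11279, -10156) [Branch (-6692, -7432) [
  Branch (5001, -8661) [Branch (-5001, -8661) [Branch (15858, 3371) [Branch (-1045, 9946) [
  Branch (11279, 10156) [Branch (6692, -7432) [Branch (-10001, 0) [Branch (-5001, 8661) []]]]]]]]]
  ]]]]]]]], Branch (8481, 5300) [Branch (18105, 2544) [Branch (4068, 9137) [Branch (6692, -7432) [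
  Branch (13587, 12234) [Branch (16702, 7436) [Branch (6692, 7432) [Branch (-10001, 0) [
  Branch (-1392, 9904) [Branch (5039, 17575) [Branch (-6692, 7432) [Branch (11279, 10156) []]]]],
  Branch (5039, 17575) [Branch (-6692, 7432) [Branch (-1392, 9904) [Branch (11279, 10156) []]]]],
  Branch (6692, 7432) [Branch (-10001, 0) [Branch (1392, 9904) [Branch (10224, 15157) [
  Branch (14142, 0) []]]], Branch (11454, -9957) [Branch (-6429, -7661) [Branch (11279, -10156) [
  Branch (1695, -16124) []]]]]]]]]]]], Branch (4384, -8989) [Branch (-6429, -7661) [
  Branch (18105, 2544) [Branch (8481, 5300) [Branch (-6692, 7432) [Branch (6692, 7432) [
  Branch (11454, -9957) [Branch (16702, 7436) [Branch (-1392, 9904) [Branch (4068, 9137) [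
  Branch (10224, 15157) [Branch (13587, 12234) [Branch (0, 15177) []]]]]]]]]],
  Branch (11454, -9957) [Branch (6692, 7432) [Branch (4068, 9137) [Branch (13587, 12234) [
  Branch (5001, 8661) [Branch (11279, -10156) [Branch (-6692, -7432) [Branch (5001, -8661) [
  Branch (-5001, -8661) [Branch (15858, 3371) [Branch (-1045, 9946) [Branch (11279, 10156) [
  Branch (6692, -7432) [Branch (-10001, 0) [Branch (-5001, 8661) []]]]]]]]]]]]]]]]],
  Branch (8481, 5300) [Branch (18105, 2544) [Branch (4068, 9137) [Branch (6692, -7432) [
  Branch (13587, 12234) [Branch (16702, 7436) [Branch (6692, 7432) [Branch (-10001, 0) [
  Branch (-1392, 9904) [Branch (5039, 17575) [Branch (-6692, 7432) [Branch (11279, 10156) []]]]],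
  Branch (5039, 17575) [Branch (-6692, 7432) [Branch (-1392, 9904) [Branch (11279, 10156) []]]]],
  Branch (6692, 7432) [Branch (-10001, 0) [Branch (1392, 9904) [Branch (10224, 15157) [
  Branch (14142, 0) []]]], Branch (11454, -9957) [Branch (-6429, -7661) [Branch (11279, -10156) [
  Branch (1695, -16124) []]]]]]]]]]]]]], Branch (1737, -9849) [Branch (5650, -17388) [
  Branch (-1392, -9904) [Branch (5039, -17575) [Branch (13017, -11315) [Branch (4384, -8989) [
  Branch (-6692, -7432) [Branch (0, -15177) [Branch (6692, -7432) [Branch (18105, 2544) [
  Branch (8481, 5300) [Branch (-6692, 7432) [Branch (4068, 9137) [Branch (-6429, -7661) [
  Branch (11454, -9957) [Branch (16702, 7436) [Branch (-1392, 9904) [Branch (10224, 15157) [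
  Branch (13587, 12234) [Branch (0, 15177) []]]]]]]]]], Branch (4068, 9137) [
  Branch (13587, 12234) [Branch (5001, 8661) [Branch (11279, -10156) [Branch (6692, 7432) [
  Branch (14142, 0) [Branch (1392, 9904) [Branch (10224, 15157) [Branch (-5001, 8661) [
  Branch (-10001, 0) [Branch (-5001, -8661) [Branch (5001, -8661) []]]]]]]]]]]]],
  Branch (18105, 2544) [Branch (8481, 5300) [Branch (-6692, 7432) [Branch (4068, 9137) [
  Branch (-6429, -7661) [Branch (11454, -9957) [Branch (16702, 7436) [Branch (-1392, 9904) [
  Branch (10224, 15157) [Branch (13587, 12234) [Branch (0, 15177) []]]]]]]]]],
  Branch (4068, 9137) [Branch (13587, 12234) [Branch (5001, 8661) [Branch (11279, -10156) [
  Branch (6692, 7432) [Branch (14142, 0) [Branch (1392, 9904) [Branch (10224, 15157) [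
  Branch (-5001, 8661) [Branch (-10001, 0) [Branch (-5001, -8661) [Branch (5001, -8661) []]]]]]]]]
  ]]]], Branch (4068, 9137) [Branch (16702, 7436) [Branch (-6692, 7432) [Branch (16432, 8015) [
  Branch (-6429, 7661) [Branch (18105, 2544) [Branch (9614, -2757) [Branch (6692, 7432) [
  Branch (0, 15177) [Branch (10224, 15157) [Branch (-1392, 9904) [Branch (8481, -5300) [
  Branch (8481, 5300) []]]]]]], Branch (9614, -2757) [Branch (6692, 7432) [Branch (0, 15177) [
  Branch (10224, 15157) [Branch (-1392, 9904) [Branch (8481, -5300) [Branch (8481, 5300) []]]]]]]]
  ]]]]]]], Branch (11279, -10156) [Branch (1695, -16124) [Branch (-5001, -8661) [
  Branch (13116, -9529) [Branch (6692, -7432) [Branch (18105, 2544) [Branch (6692, 7432) []],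
  Branch (18105, 2544) [Branch (6692, 7432) []]]]]]]], Branch (18105, 2544) [Branch (8481, 5300) [
  Branch (8481, -5300) [Branch (6692, 7432) [Branch (9614, -2757) [Branch (-6692, -7432) [
  Branch (0, -15177) []]]]]], Branch (8481, 5300) [Branch (8481, -5300) [Branch (6692, 7432) [
  Branch (9614, -2757) [Branch (-6692, -7432) [Branch (0, -15177) []]]]]], Branch (4068, 9137) [
  Branch (13587, 12234) [Branch (6692, -7432) [Branch (16702, 7436) [Branch (6692, 7432) [
  Branch (-10001, 0) [Branch (0, -15177) [Branch (-1392, 9904) [Branch (-6692, -7432) [
  Branch (-6692, 7432) [Branch (11279, 10156) []]]]]], Branch (5039, 17575) [
  Branch (-6692, 7432) [Branch (-1392, 9904) [Branch (11279, 10156) []]]]], Branch (6692, 7432) [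
  Branch (-10001, 0) [Branch (1392, 9904) [Branch (10224, 15157) [Branch (14142, 0) []]]],
  Branch (11454, -9957) [Branch (-5001, -8661) [Branch (11279, -10156) [Branch (1695, -16124) []]]
  ]]], Branch (16702, 7436) [Branch (6692, 7432) [Branch (-10001, 0) [Branch (0, -15177) [
  Branch (-1392, 9904) [Branch (-6692, -7432) [Branch (-6692, 7432) [Branch (11279, 10156) []]]]]
  ], Branch (5039, 17575) [Branch (-6692, 7432) [Branch (-1392, 9904) [Branch (11279, 10156) []]]]
  ], Branch (6692, 7432) [Branch (-10001, 0) [Branch (1392, 9904) [Branch (10224, 15157) [
  Branch (14142, 0) []]]], Branch (11454, -9957) [Branch (-5001, -8661) [Branch (11279, -10156) [
  Branch (1695, -16124) []]]]]]]]]]]]]]]]], Branch (1737, -9849) [Branch (9688, -15505) [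
  Branch (4384, -8989) [Branch (16702, 7436) [Branch (6692, -7432) [Branch (6692, 7432) [
  Branch (18105, 2544) [Branch (14005, -11752) [Branch (14142, 0) [Branch (1392, 9904) [
  Branch (10224, 15157) []]]], Branch (-6692, -7432) [Branch (11279, -10156) [
  Branch (15858, 3371) [Branch (-1045, 9946) [Branch (10224, 15157) [Branch (1392, 9904) [
  Branch (6429, -7661) [Branch (13116, 9529) [Branch (-6692, 7432) [Branch (4068, 9137) [
  Branch (-10001, 0) [Branch (0, 15177) []]], Branch (-10001, 0) [Branch (4068, 9137) [
  Branch (-5001, -8661) [Branch (5001, -8661) []]], Branch (-5001, 8661) [Branch (5001, 8661) [
  Branch (16403, -5330) [Branch (1695, 16124) [Branch (17575, 5039) [Branch (12234, 13587) []]]]]]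
  ]]]]]]]]], Branch (-6692, 7432) [Branch (4068, 9137) [Branch (9688, 15505) [
  Branch (-1392, 9904) [Branch (-10001, 0) [Branch (10224, 15157) [Branch (13587, 12234) [
  Branch (0, 15177) []]]]]]], Branch (4068, 9137) [Branch (5001, 8661) [Branch (3091, 9512) [
  Branch (13116, 9529) [Branch (-5001, 8661) [Branch (-10001, 0) [Branch (10224, 15157) [
  Branch (0, 15177) []]]]]]]]]]], Branch (11279, -10156) [Branch (-6692, -7432) [
  Branch (-6692, 7432) [Branch (4068, 9137) [Branch (5001, -8661) [Branch (-5001, -8661) [
  Branch (-4423, -17740) [Branch (-9783, -2079) [Branch (3091, 9512) [Branch (13116, 9529) [
  Branch (-5001, 8661) [Branch (-10001, 0) [Branch (-1695, -16124) []]]]]]]]]]]]]],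
  Branch (6692, 7432) [Branch (18105, 2544) [Branch (14005, -11752) [Branch (14142, 0) [
  Branch (1392, 9904) [Branch (10224, 15157) []]]], Branch (-6692, -7432) [
  Branch (11279, -10156) [Branch (15858, 3371) [Branch (-1045, 9946) [Branch (10224, 15157) [
  Branch (1392, 9904) [Branch (6429, -7661) [Branch (13116, 9529) [Branch (-6692, 7432) [
  Branch (4068, 9137) [Branch (-10001, 0) [Branch (0, 15177) []]], Branch (-10001, 0) [
  Branch (4068, 9137) [Branch (-5001, -8661) [Branch (5001, -8661) []]], Branch (-5001, 8661) [
  Branch (5001, 8661) [Branch (16403, -5330) [Branch (1695, 16124) [Branch (17575, 5039) [
  Branch (12234, 13587) []]]]]]]]]]]]]]], Branch (-6692, 7432) [Branch (4068, 9137) [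
  Branch (9688, 15505) [Branch (-1392, 9904) [Branch (-10001, 0) [Branch (10224, 15157) [
  Branch (13587, 12234) [Branch (0, 15177) []]]]]]], Branch (4068, 9137) [Branch (5001, 8661) [
  Branch (3091, 9512) [Branch (13116, 9529) [Branch (-5001, 8661) [Branch (-10001, 0) [
  Branch (10224, 15157) [Branch (0, 15177) []]]]]]]]]]], Branch (11279, -10156) [
  Branch (-6692, -7432) [Branch (-6692, 7432) [Branch (4068, 9137) [Branch (5001, -8661) [
  Branch (-5001, -8661) [Branch (-4423, -17740) [Branch (-9783, -2079) [Branch (3091, 9512) [
  Branch (13116, 9529) [Branch (-5001, 8661) [Branch (-10001, 0) [Branch (-1695, -16124) []]]]]]]]
  ]]]]]], Branch (5650, -17388) [Branch (-6692, -7432) [Branch (8481, -5300) [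
  Branch (6692, 7432) [Branch (18105, 2544) [Branch (1392, 9904) [Branch (10224, 15157) [
  Branch (15858, 3371) [Branch (-1045, 9946) []]]]]], Branch (6692, 7432) [Branch (18105, 2544) [
  Branch (1392, 9904) [Branch (10224, 15157) [Branch (15858, 3371) [Branch (-1045, 9946) []]]]]]]]
  ]], Branch (5001, 8661) [Branch (8481, -5300) [Branch (6692, 7432) [Branch (16173, 1131) [
  Branch (11454, -9957) [Branch (-6429, -7661) [Branch (6692, -7432) [Branch (-10001, 0) [
  Branch (-5001, 8661) [Branch (10224, 15157) [Branch (1392, 9904) [Branch (6429, -7661) [
  Branch (16403, -5330) [Branch (17575, 5039) [Branch (12234, 13587) [Branch (3091, 9512) [
  Branch (5001, -8661) []]]]]]]]], Branch (-3421, -9398) [Branch (-5001, 8661) [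
  Branch (13116, 9529) [Branch (-1392, 9904) [Branch (5039, 17575) [Branch (-5001, -8661) [
  Branch (5001, -8661) [Branch (15858, 3371) []]]]]]]]], Branch (0, -15177) [
  Branch (-6692, -7432) [Branch (-1392, 9904) [Branch (1392, 9904) [Branch (10224, 15157) []]]]]]]
  ]]], Branch (6692, 7432) [Branch (16173, 1131) [Branch (11454, -9957) [Branch (-6429, -7661) [
  Branch (6692, -7432) [Branch (-10001, 0) [Branch (-5001, 8661) [Branch (10224, 15157) [
  Branch (1392, 9904) [Branch (6429, -7661) [Branch (16403, -5330) [Branch (17575, 5039) [
  Branch (12234, 13587) [Branch (3091, 9512) [Branch (5001, -8661) []]]]]]]]],
  Branch (-3421, -9398) [Branch (-5001, 8661) [Branch (13116, 9529) [Branch (-1392, 9904) [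
  Branch (5039, 17575) [Branch (-5001, -8661) [Branch (5001, -8661) [Branch (15858, 3371) []]]]]]]
  ]], Branch (0, -15177) [Branch (-6692, -7432) [Branch (-1392, 9904) [Branch (1392, 9904) [
  Branch (10224, 15157) []]]]]]]]]]]]], Branch (14005, -11752) [Branch (16702, 7436) [
  Branch (4068, 9137) [Branch (5001, 8661) [Branch (8481, -5300) [Branch (6692, 7432) [
  Branch (16173, 1131) [Branch (6692, -7432) [Branch (-10001, 0) [Branch (-3421, -9398) [
  Branch (-5001, 8661) [Branch (10224, 15157) [Branch (1392, 9904) [Branch (6429, -7661) [
  Branch (13587, 12234) [Branch (16403, -5330) [Branch (0, 15177) [Branch (-6692, 7432) [
  Branch (1695, 16124) [Branch (17575, 5039) [Branch (12234, 13587) []]]]]]]]]]]]],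
  Branch (1392, 9904) [Branch (10224, 15157) [Branch (13116, 9529) [Branch (-5001, 8661) [
  Branch (-10001, 0) [Branch (9688, 15505) [Branch (-6692, 7432) [Branch (-3291, 16931) []]]]]]]]]
  ]], Branch (6692, 7432) [Branch (16173, 1131) [Branch (6692, -7432) [Branch (-10001, 0) [
  Branch (-3421, -9398) [Branch (-5001, 8661) [Branch (10224, 15157) [Branch (1392, 9904) [
  Branch (6429, -7661) [Branch (13587, 12234) [Branch (16403, -5330) [Branch (0, 15177) [
  Branch (-6692, 7432) [Branch (1695, 16124) [Branch (17575, 5039) [Branch (12234, 13587) []]]]]]]
  ]]]]]], Branch (1392, 9904) [Branch (10224, 15157) [Branch (13116, 9529) [Branch (-5001, 8661) [
  Branch (-10001, 0) [Branch (9688, 15505) [Branch (-6692, 7432) [Branch (-3291, 16931) []]]]]]]]]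
  ]]]]], Branch (6692, -7432) [Branch (6692, 7432) [Branch (14142, 0) [Branch (11454, -9957) [
  Branch (6429, 7661) [Branch (-10001, 0) [Branch (5001, 8661) [Branch (5001, -8661) [
  Branch (16403, 5330) [Branch (3091, -9512) [Branch (12234, -13587) [Branch (17575, -5039) []]]]]
  ], Branch (0, -15177) [Branch (-3421, -9398) [Branch (-5001, -8661) [Branch (5001, -8661) [
  Branch (-6692, -7432) [Branch (-1392, 9904) [Branch (-5001, 8661) [Branch (13116, 9529) []]],
  Branch (1695, -16124) [Branch (12234, -13587) [Branch (17575, -5039) [Branch (16403, 5330) [
  Branch (1392, 9904) [Branch (10224, 15157) []]]]]]]]]]]]]]]], Branch (6692, 7432) [
  Branch (14142, 0) [Branch (11454, -9957) [Branch (6429, 7661) [Branch (-10001, 0) [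
  Branch (5001, 8661) [Branch (5001, -8661) [Branch (16403, 5330) [Branch (3091, -9512) [
  Branch (12234, -13587) [Branch (17575, -5039) []]]]]], Branch (0, -15177) [
  Branch (-3421, -9398) [Branch (-5001, -8661) [Branch (5001, -8661) [Branch (-6692, -7432) [
  Branch (-1392, 9904) [Branch (-5001, 8661) [Branch (13116, 9529) []]], Branch (1695, -16124) [
  Branch (12234, -13587) [Branch (17575, -5039) [Branch (16403, 5330) [Branch (1392, 9904) [
  Branch (10224, 15157) []]]]]]]]]]]]]]]], Branch (0, -15177) [Branch (-6692, -7432) [
  Branch (11454, -9957) [Branch (-6429, -7661) [Branch (11279, -10156) [Branch (1695, -16124) []]]
  ]]]]]]]]]]]]])
  [[(0, 0)], [(0, 0)], [(0, 0)], [(10003, 0)], [(10003, 0)]]"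
  by code_simp

text \<open>The scale is 1000, and 4040099 is one less than the square of 2010. The outer radius
  exceeds 2, so even the first vertex, which is almost antipodal to \<open>(1003, 0)\<close> with
  respect to the origin, is adjacent to it.\<close>

lemma refutes_10_colors:
  "refutes 10 (annulus_adj 1000000 4040099) (
  Branch (-1001, 0) [Branch (501, 867) [Branch (-501, -867) [Branch (-501, 867) [
  Branch (501, -867) [Branch (-867, -501) [Branch (-867, 501) [Branch (0, 1001) [
  Branch (-335, 1467) [Branch (1103, 1024) [Branch (592, 1920) [Branch (706, 1035) [
  Branch (-434, 902) [Branch (-998, 75) [Branch (781, 980) [Branch (-223, 976) [
  Branch (-957, 295) [Branch (-734, -681) [Branch (-187, 1239) []]]]]]]]]], Branch (1522, 878) [
  Branch (872, 1810) [Branch (592, 1920) [Branch (1103, 1024) [Branch (1958, 447) [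
  Branch (1103, -1024) [Branch (75, -998) [Branch (1920, -592) [Branch (1958, -447) [
  Branch (94, -1250) [Branch (-734, -681) [Branch (734, -1870) []]]]]]]]]]], Branch (872, 1810) [
  Branch (592, 1920) [Branch (1103, 1024) [Branch (1958, 447) [Branch (781, -980) [
  Branch (544, 1129) [Branch (-434, 902) [Branch (-998, 75) [Branch (1920, -592) [
  Branch (1024, 1103) [Branch (1920, 592) [Branch (1958, -447) [Branch (1103, -1024) [
  Branch (1366, -1473) [Branch (94, -1250) [Branch (-734, -681) [Branch (-957, 295) [
  Branch (-223, 976) [Branch (781, 980) [Branch (1870, 734) [Branch (1986, -299) [
  Branch (1571, -1252) [Branch (734, -1870) [Branch (295, -957) [Branch (1288, -1195) [
  Branch (-706, -1035) [Branch (279, -1222) [Branch (-1737, 262) [Branch (-852, -919) [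
  Branch (-299, -1986) [Branch (902, -434) []]], Branch (-852, -919) [Branch (-299, -1986) [
  Branch (902, -434) []]]]]]]]]]]]]]]]]]]]]], Branch (781, 980) [Branch (1920, 592) [
  Branch (1958, -447) [Branch (1366, -1473) []]]]]]]]]]]]], Branch (-434, 902) [
  Branch (706, 1035) [Branch (1958, -447) [Branch (544, 1129) [Branch (1374, 1095) [
  Branch (734, 1870) [Branch (1986, 299) [Branch (1571, 1252) []]]]]]]]]]]], Branch (75, -998) [
  Branch (0, -1001) [Branch (1103, -1024) [Branch (1958, -447) [Branch (706, 1035) [
  Branch (-434, 902) [Branch (1522, 878) [Branch (1958, 447) [Branch (872, 1810) [
  Branch (592, 1920) [Branch (1103, 1024) [Branch (-734, 681) [Branch (94, 1250) []]]]],
  Branch (781, -980) [Branch (-998, -75) [Branch (-434, -902) [Branch (706, -1035) []]]]]]]],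
  Branch (706, -1035) [Branch (-434, -902) [Branch (-998, -75) [Branch (781, -980) [
  Branch (-223, -976) [Branch (-957, -295) [Branch (-734, 681) [Branch (592, -1920) [
  Branch (-187, -1239) []]]]]]]]]], Branch (-335, -1467) [Branch (592, -1920) [
  Branch (1958, -447) [Branch (1452, -990) [Branch (734, -1870) [Branch (706, 1035) [
  Branch (-434, 902) [Branch (-998, 75) [Branch (781, 980) [Branch (1986, -299) [
  Branch (1571, -1252) [Branch (544, -1129) [Branch (-434, -902) [Branch (-998, -75) [
  Branch (1920, -592) [Branch (1958, 447) [Branch (1103, 1024) [Branch (1473, 1366) [
  Branch (94, 1250) [Branch (-734, 681) [Branch (-957, -295) [Branch (-223, -976) [
  Branch (-458, -1166) [Branch (-1737, 262) [Branch (-852, 919) [Branch (-1583, -762) []],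
  Branch (-852, 919) [Branch (-1583, -762) []]]]]]]]]]], Branch (781, -980) [Branch (1920, 592) [
  Branch (1024, -1103) []]]]]]]]]]]]]]]]]]]]]]]]]]])
  [[(0, 0)], [(0, 0)], [(0, 0)], [(1003, 0)], [(1003, 0)]]"
  by code_simp

section \<open>Combination of the threshold bounds with the certificates\<close>

theorem theorem3p2:
  fixes b :: real
  shows "(b > sqrt (2 - 2 * sin (18 * pi / 325)) \<longrightarrow> chromatic_number (annulus_graph b) \<ge> 7)
    \<and> (b > sqrt (2 + 2 * sin (pi / 38)) \<longrightarrow> chromatic_number (annulus_graph b) \<ge> 8)
    \<and> (b > sqrt (2 + 2 * sin (7 * pi / 45)) \<longrightarrow> chromatic_number (annulus_graph b) \<ge> 9)
    \<and> (b > 2 * sqrt 2 - 1 \<longrightarrow> chromatic_number (annulus_graph b) \<ge> 10)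
    \<and> (b > 1 / 3 * (5 - sqrt 2 + sqrt 6) \<longrightarrow> chromatic_number (annulus_graph b) \<ge> 11)"
proof (intro conjI impI)
  assume "b > sqrt (2 - 2 * sin (18 * pi / 325))"
  then have "b > 12859 / 10000" using threshold_bounds(1) by simp
  then have "enat (Suc 6) \<le> chromatic_number (annulus_graph b)"
    \<comment> \<open>The rational lower bound on \<open>b\<close> determines \<open>b'\<close>, and
      the certificate determines \<open>l\<close>, \<open>m\<close>, \<open>q\<close> and
      \<open>k\<close>. What remains are comparisons of numerals. The other four cases differ only
      in the scale and the certificate.\<close>
    by (rule chromatic_number_annulus_ge[where s = 100000, OF _ _ _ _ _ _ _ refutes_6_colors])
      (simp_all add: power2_eq_square)
  then show "chromatic_number (annulus_graph b) \<ge> 7"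
    by (simp add: numeral_eq_enat)
next
  assume "b > sqrt (2 + 2 * sin (pi / 38))"
  then have "b > 14705 / 10000" using threshold_bounds(2) by simp
  then have "enat (Suc 7) \<le> chromatic_number (annulus_graph b)"
    by (rule chromatic_number_annulus_ge[where s = 1000, OF _ _ _ _ _ _ _ refutes_7_colors])
      (simp_all add: power2_eq_square)
  then show "chromatic_number (annulus_graph b) \<ge> 8"
    by (simp add: numeral_eq_enat)
next
  assume "b > sqrt (2 + 2 * sin (7 * pi / 45))"
  then have "b > 1714 / 1000" using threshold_bounds(3) by simp
  then have "enat (Suc 8) \<le> chromatic_number (annulus_graph b)"
    by (rule chromatic_number_annulus_ge[where s = 1000, OF _ _ _ _ _ _ _ refutes_8_colors])
      (simp_all add: power2_eq_square)
  then show "chromatic_number (annulus_graph b) \<ge> 9"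
    by (simp add: numeral_eq_enat)
next
  assume "b > 2 * sqrt 2 - 1"
  then have "b > 18284 / 10000" using threshold_bounds(4) by simp
  then have "enat (Suc 9) \<le> chromatic_number (annulus_graph b)"
    by (rule chromatic_number_annulus_ge[where s = 10000, OF _ _ _ _ _ _ _ refutes_9_colors])
      (simp_all add: power2_eq_square)
  then show "chromatic_number (annulus_graph b) \<ge> 10"
    by (simp add: numeral_eq_enat)
next
  assume "b > 1 / 3 * (5 - sqrt 2 + sqrt 6)"
  then have "b > 201 / 100" using threshold_bounds(5) by simp
  then have "enat (Suc 10) \<le> chromatic_number (annulus_graph b)"
    by (rule chromatic_number_annulus_ge[where s = 1000, OF _ _ _ _ _ _ _ refutes_10_colors])
      (simp_all add: power2_eq_square)
  then show "chromatic_number (annulus_graph b) \<ge> 11"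
    by (simp add: numeral_eq_enat)
qed

end
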